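(* Let $l$ be a prime with $l\equiv 4 \pmod 5$. Define $$f_0(x)=x^4+12x^3+14x^2-12x+1,\quad f_{1728}(x)=x^4+18x^3+74x^2-18x+1,$$ and for $j\in\mathbb{F}_l$, $f_j(x)=(x^4+12x^3+14x^2-12x+1)^3-jx^5(1-11x-x^2)\in\mathbb{F}_l[x]$. If $0$ is a supersingular $j$-invariant in characteristic $l$, then $f_0(x)$ has exactly $4$ distinct linear factors over $\mathbb{F}_l$; if $1728$ is a supersingular $j$-invariant in characteristic $l$, then $f_{1728}(x)$ has exactly $4$ distinct linear factors over $\mathbb{F}_l$; and if $j\in\mathbb{F}_l$, $j\neq 0,1728$, is a supersingular $j$-invariant in characteristic $l$, then $f_j(x)$ has exactly $4$ distinct linear factors over $\mathbb{F}_l$.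
   Context: A $j$-invariant $j\in\overline{\mathbb{F}}_l$ is supersingular if it is the $j$-invariant of a supersingular elliptic curve over $\overline{\mathbb{F}}_l$. *)

theory Defs
  imports "Berlekamp_Zassenhaus.Finite_Field" "HOL-Computational_Algebra.Polynomial"
begin

datatype 'k ec_point = Inf | Pt 'k 'k

definition on_curve :: "'k::field \<Rightarrow> 'k \<Rightarrow> 'k ec_point \<Rightarrow> bool" where
  "on_curve a b P = (case P of Inf \<Rightarrow> True | Pt x y \<Rightarrow> y^2 = x^3 + a*x + b)"

text \<open>Chord-and-tangent group law (valid in characteristic different from 2 and 3).\<close>
fun ec_add :: "'k::field \<Rightarrow> 'k ec_point \<Rightarrow> 'k ec_point \<Rightarrow> 'k ec_point" where
  "ec_add a Inf P = P"
| "ec_add a P Inf = P"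
| "ec_add a (Pt x1 y1) (Pt x2 y2) =
     (if x1 = x2 \<and> y1 = - y2 then Inf
      else let lam = (if x1 = x2 then (3 * x1^2 + a) / (2 * y1) else (y2 - y1) / (x2 - x1));
               x3 = lam^2 - x1 - x2
           in Pt x3 (lam * (x1 - x3) - y1))"

fun ec_mult :: "'k::field \<Rightarrow> nat \<Rightarrow> 'k ec_point \<Rightarrow> 'k ec_point" where
  "ec_mult a 0 P = Inf"
| "ec_mult a (Suc n) P = ec_add a P (ec_mult a n P)"

definition elliptic :: "'k::field \<Rightarrow> 'k \<Rightarrow> bool" where
  "elliptic a b = (4 * a^3 + 27 * b^2 \<noteq> 0)"

definition j_invariant :: "'k::field \<Rightarrow> 'k \<Rightarrow> 'k" where
  "j_invariant a b = 1728 * (4 * a^3) / (4 * a^3 + 27 * b^2)"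

text \<open>Supersingular (Silverman's definition): the l-torsion E[l] is trivial, l = characteristic.\<close>
definition supersingular_curve :: "nat \<Rightarrow> 'k::field \<Rightarrow> 'k \<Rightarrow> bool" where
  "supersingular_curve l a b =
     (\<forall>P. on_curve a b P \<and> ec_mult a l P = Inf \<longrightarrow> P = Inf)"

definition supersingular_j :: "nat \<Rightarrow> 'k::field \<Rightarrow> bool" where
  "supersingular_j l j =
     (\<exists>a b. elliptic a b \<and> j_invariant a b = j \<and> supersingular_curve l a b)"

definition is_alg_closure_of_Fp :: "nat \<Rightarrow> 'k::field itself \<Rightarrow> bool" where
  "is_alg_closure_of_Fp l _ =
     (prime l \<and> of_nat l = (0::'k)
      \<and> (\<forall>p::'k poly. degree p > 0 \<longrightarrow> (\<exists>x. poly p x = 0))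
      \<and> (\<forall>x::'k. \<exists>n>0. x ^ (l ^ n) = x))"

text \<open>Embedding of F_l = 'p mod_ring into a field of characteristic l.\<close>
definition emb :: "'p::prime_card mod_ring \<Rightarrow> 'k::field" where
  "emb j = of_int (to_int_mod_ring j)"

definition f0 :: "'a::comm_ring_1 poly" where
  "f0 = [:1, -12, 14, 12, 1:]"

definition f1728 :: "'a::comm_ring_1 poly" where
  "f1728 = [:1, -18, 74, 18, 1:]"

definition fj :: "'a::comm_ring_1 \<Rightarrow> 'a poly" where
  "fj j = [:1, -12, 14, 12, 1:] ^ 3 - smult j (monom 1 5 * [:1, -11, -1:])"

definition num_distinct_linear_factors :: "'a::field poly \<Rightarrow> nat" where
  "num_distinct_linear_factors f = card {g. monic g \<and> degree g = 1 \<and> g dvd f}"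

end

theory Submission
  imports Defs "HOL-Algebra.Sylow"
begin

text \<open>
  A supersingular invariant in \<open>F\<^sub>l\<close> has a model \<open>y\<^sup>2 = f(x)\<close> over \<open>F\<^sub>l\<close>. Counting points modulo
  \<open>l\<close> gives \<open>#E(F\<^sub>q) = 1 - A\<^sup>n\<close> for \<open>q = l\<^sup>n\<close> and \<open>A\<close> the Hasse invariant; if \<open>A\<close> were nonzero,
  \<open>n = l - 1\<close> would produce a point of order \<open>l\<close>. Hence \<open>A = 0\<close> and \<open>#E(F\<^sub>l)\<close> is \<open>1\<close>, \<open>l + 1\<close> or
  \<open>2l + 1\<close>; the extreme values would make \<open>f\<^bsup>(l-1)/2\<^esup>\<close> constant on \<open>F\<^sub>l\<close>, so that
  \<open>#E(F\<^sub>l) = l + 1\<close> is divisible by 5. A rational point of order 5 puts the curve into Tate normal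
  form with parameter \<open>t\<close>, and \<open>- t\<close> is a rational root of \<open>f\<^sub>j\<close>, and of \<open>f\<^sub>0\<close> or \<open>f\<^bsub>1728\<^esub>\<close> if \<open>j\<close> is
  \<open>0\<close> or \<open>1728\<close>.

  One root determines the others. In terms of \<open>n = x - 1/x + 11\<close> the polynomial \<open>f\<^sub>j\<close> becomes a
  sextic in \<open>n\<close>, and \<open>f\<^sub>0\<close>, \<open>f\<^bsub>1728\<^esub>\<close> become quadratics that split over \<open>F\<^sub>l\<close> because \<open>5\<close> is a
  square. Each relevant \<open>n\<close> that comes from a rational \<open>x\<close> comes from two of them. If \<open>n\<close> is such a
  root of the sextic, then \<open>125/n = y - 1/y + 11\<close> with \<open>y\<close> rational, and the remaining roots are
  \<open>n p\<^sup>6/125\<close> where \<open>p = s - 1/s + 1\<close> and \<open>s\<close> runs over the fifth roots of \<open>y\<close>. Frobenius permutes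
  these as it permutes the \<open>s\<close>, exactly one of which is rational because \<open>5\<close> does not divide \<open>l - 1\<close>.
\<close>

section \<open>The group law\<close>

lemma on_curve_simps [simp]:
  "on_curve a b Inf" "on_curve a b (Pt x y) \<longleftrightarrow> y^2 = x^3 + a*x + b"
  by (simp_all add: on_curve_def)

lemma ec_add_Inf_right [simp]: "ec_add a P Inf = P"
  by (cases P) auto

fun ec_neg :: "'k::field ec_point \<Rightarrow> 'k ec_point" where
  "ec_neg Inf = Inf"
| "ec_neg (Pt x y) = Pt x (- y)"

lemma ec_neg_ec_neg [simp]: "ec_neg (ec_neg P) = P"
  by (cases P) auto

lemma on_curve_ec_neg [simp]: "on_curve a b (ec_neg P) \<longleftrightarrow> on_curve a b P"
  by (cases P) auto

lemma ec_add_ec_neg [simp]: "ec_add a P (ec_neg P) = Inf" "ec_add a (ec_neg P) P = Inf"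
  by (cases P; simp)+

definition ec_slope :: "'k::field \<Rightarrow> 'k \<Rightarrow> 'k \<Rightarrow> 'k \<Rightarrow> 'k \<Rightarrow> 'k" where
  "ec_slope a x1 y1 x2 y2 = (if x1 = x2 then (3 * x1^2 + a) / (2 * y1) else (y2 - y1) / (x2 - x1))"

definition chord_sum :: "'k::field \<Rightarrow> 'k \<Rightarrow> 'k \<Rightarrow> 'k \<Rightarrow> 'k ec_point" where
  "chord_sum m x1 y1 x2 = Pt (m^2 - x1 - x2) (m * (x1 - (m^2 - x1 - x2)) - y1)"

lemma ec_add_Pt:
  "ec_add a (Pt x1 y1) (Pt x2 y2) =
    (if x1 = x2 \<and> y1 = - y2 then Inf else chord_sum (ec_slope a x1 y1 x2 y2) x1 y1 x2)"
  by (simp add: ec_slope_def chord_sum_def Let_def)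

declare ec_add.simps(3) [simp del]

text \<open>On the curve these two conditions characterise the slope of the chord and of the tangent
  at once, so that no later argument has to distinguish the two.\<close>

definition is_slope :: "'k::field \<Rightarrow> 'k \<Rightarrow> 'k \<Rightarrow> 'k \<Rightarrow> 'k \<Rightarrow> 'k \<Rightarrow> bool" where
  "is_slope a m x1 y1 x2 y2 \<longleftrightarrow>
    y2 - y1 = m * (x2 - x1) \<and> m * (y1 + y2) = x1^2 + x1*x2 + x2^2 + a"

lemma is_slope_commute: "is_slope a m x1 y1 x2 y2 \<longleftrightarrow> is_slope a m x2 y2 x1 y1"
  by (auto simp: is_slope_def algebra_simps)

lemma is_slope_solved:
  assumes "is_slope a m x1 y1 x2 y2"
  shows "y2 = y1 + m * (x2 - x1)" "a = m * (y1 + y2) - x1^2 - x1*x2 - x2^2"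
  using assms by (simp_all add: is_slope_def algebra_simps)

lemma ec_add_eq_chord_sum:
  assumes "\<not> (x1 = x2 \<and> y1 = - y2)" "is_slope a m x1 y1 x2 y2"
  shows "ec_add a (Pt x1 y1) (Pt x2 y2) = chord_sum m x1 y1 x2"
proof -
  have "ec_slope a x1 y1 x2 y2 = m"
  proof (cases "x1 = x2")
    case False
    then show ?thesis using assms(2) by (simp add: ec_slope_def is_slope_def)
  next
    case True
    with assms have y2_eq: "y2 = y1" "y1 \<noteq> - y1" by (auto simp: is_slope_def)
    then have "2 * y1 \<noteq> 0" by (metis add_cancel_right_left add_eq_0_iff mult_2)
    moreover have "m * (2 * y1) = 3 * x1^2 + a"
      using assms(2) True y2_eq by (simp add: is_slope_def power2_eq_square algebra_simps)
    ultimately show ?thesis using True by (simp add: ec_slope_def nonzero_divide_eq_eq)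
  qed
  then show ?thesis using assms(1) by (auto simp: ec_add_Pt)
qed

lemma chord_sum_commute:
  assumes "is_slope a m x1 y1 x2 y2" shows "chord_sum m x1 y1 x2 = chord_sum m x2 y2 x1"
  using is_slope_solved(1)[OF assms] by (simp add: chord_sum_def algebra_simps)

locale elliptic_curve =
  fixes a b :: "'k::field"
  assumes two_nonzero: "(2::'k) \<noteq> 0" and elliptic: "elliptic a b"
begin

abbreviation add (infixl "\<oplus>\<^sub>E" 65) where "P \<oplus>\<^sub>E Q \<equiv> ec_add a P Q"
abbreviation on where "on \<equiv> on_curve a b"

lemma is_slope_ec_slope:
  assumes "on (Pt x1 y1)" "on (Pt x2 y2)" "\<not> (x1 = x2 \<and> y1 = - y2)"
  shows "is_slope a (ec_slope a x1 y1 x2 y2) x1 y1 x2 y2"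
proof (cases "x1 = x2")
  case False
  define m where "m = ec_slope a x1 y1 x2 y2"
  have slope: "y2 - y1 = m * (x2 - x1)" using False by (simp add: m_def ec_slope_def)
  have "(x2 - x1) * (m * (y1 + y2)) = (y2 - y1) * (y1 + y2)"
    unfolding slope by (simp add: mult_ac)
  also have "\<dots> = y2^2 - y1^2" by (simp add: algebra_simps power2_eq_square)
  also have "\<dots> = (x2^3 + a*x2 + b) - (x1^3 + a*x1 + b)" using assms by simp
  also have "\<dots> = (x2 - x1) * (x1^2 + x1*x2 + x2^2 + a)" by Groebner_Basis.algebra
  finally show ?thesis using slope False by (simp add: is_slope_def m_def)
next
  case True
  then have "y2^2 = y1^2" using assms by simp
  then have y2_eq: "y2 = y1" using assms(3) True by (auto simp: power2_eq_iff)
  then have "2 * y1 \<noteq> 0"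
    using assms(3) True two_nonzero by (auto simp: eq_neg_iff_add_eq_0)
  then have "(3 * x1^2 + a) / (2 * y1) * (y1 + y2) = 3 * x1^2 + a"
    unfolding y2_eq by (metis mult_2 nonzero_divide_eq_eq)
  then show ?thesis using True y2_eq by (simp add: is_slope_def ec_slope_def power2_eq_square)
qed

lemma add_cases:
  assumes "on P" "on Q"
  obtains (Inf_left) "P = Inf" | (Inf_right) "Q = Inf" | (opposite) "Q = ec_neg P"
  | (chord) x1 y1 x2 y2 m where "P = Pt x1 y1" "Q = Pt x2 y2" "is_slope a m x1 y1 x2 y2"
      "\<not> (x1 = x2 \<and> y1 = - y2)" "P \<oplus>\<^sub>E Q = chord_sum m x1 y1 x2"
proof (cases P; cases Q)
  fix x1 y1 x2 y2 assume points: "P = Pt x1 y1" "Q = Pt x2 y2"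
  show thesis
  proof (cases "x1 = x2 \<and> y1 = - y2")
    case True
    then show thesis using opposite points by auto
  next
    case False
    then have "is_slope a (ec_slope a x1 y1 x2 y2) x1 y1 x2 y2"
      using is_slope_ec_slope assms points by blast
    then show thesis using chord ec_add_eq_chord_sum False points by blast
  qed
qed (use Inf_left Inf_right in auto)

lemma add_commute:
  assumes "on P" "on Q" shows "P \<oplus>\<^sub>E Q = Q \<oplus>\<^sub>E P"
  using assms
proof (cases rule: add_cases)
  case (chord x1 y1 x2 y2 m)
  have "Q \<oplus>\<^sub>E P = chord_sum m x2 y2 x1"
    unfolding chord(1,2)
    by (rule ec_add_eq_chord_sum) (use chord in \<open>auto simp: is_slope_commute[of a m x2]\<close>)
  then show ?thesis using chord chord_sum_commute by metis
qed auto

lemma on_chord_sum: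
  assumes "on (Pt x1 y1)" "is_slope a m x1 y1 x2 y2" shows "on (chord_sum m x1 y1 x2)"
proof -
  have b_eq: "b = y1^2 - x1^3 - a*x1" using assms(1) by simp
  show ?thesis
    unfolding chord_sum_def on_curve_simps b_eq
    unfolding is_slope_solved(2)[OF assms(2)] is_slope_solved(1)[OF assms(2)]
    by Groebner_Basis.algebra
qed

lemma on_add [simp]:
  assumes "on P" "on Q" shows "on (P \<oplus>\<^sub>E Q)"
  using assms
proof (cases rule: add_cases)
  case (chord x1 y1 x2 y2 m)
  then show ?thesis using on_chord_sum assms(1) by metis
qed (use assms in auto)

lemma nonsingular:
  assumes "x^3 + a*x + b = 0" "3 * x^2 + a = 0" shows False
proof -
  have a_eq: "a = - (3 * x^2)" using assms(2) by (simp add: eq_neg_iff_add_eq_0 add.commute)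
  have "b = - (x^3) - a*x" using assms(1) by (simp add: algebra_simps eq_neg_iff_add_eq_0)
  then have b_eq: "b = 2 * x^3" unfolding a_eq by (simp add: power2_eq_square power3_eq_cube)
  have "4 * a^3 + 27 * b^2 = 0" unfolding a_eq b_eq by Groebner_Basis.algebra
  then show False using elliptic by (simp add: elliptic_def)
qed

lemma add_neg_cancel:
  assumes "on P" "on Q" shows "(P \<oplus>\<^sub>E Q) \<oplus>\<^sub>E ec_neg Q = P"
  using assms
proof (cases rule: add_cases)
  case (chord x1 y1 x2 y2 m)
  define x3 y3 where "x3 = m^2 - x1 - x2" and "y3 = m * (x1 - x3) - y1"
  have sum: "P \<oplus>\<^sub>E Q = Pt x3 y3" using chord(5) by (simp add: chord_sum_def x3_def y3_def)
  note y2_eq = is_slope_solved(1)[OF chord(3)] and a_eq = is_slope_solved(2)[OF chord(3)]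
  have "- m * (y3 + - y2) = x3^2 + x3*x2 + x2^2 + a"
    unfolding y3_def x3_def a_eq y2_eq by Groebner_Basis.algebra
  moreover have "- y2 - y3 = - m * (x2 - x3)" by (simp add: y2_eq y3_def algebra_simps)
  ultimately have slope: "is_slope a (- m) x3 y3 x2 (- y2)" by (simp add: is_slope_def)
  have "\<not> (x3 = x2 \<and> y3 = - (- y2))"
  proof
    assume tangent: "x3 = x2 \<and> y3 = - (- y2)"
    then have "y2 = 0" using slope two_nonzero by (simp add: is_slope_def)
    moreover have "3 * x2^2 + a = 0"
      using slope tangent by (simp add: is_slope_def algebra_simps power2_eq_square)
    ultimately show False using nonsingular[of x2] assms chord(2) by simp
  qed
  then have "Pt x3 y3 \<oplus>\<^sub>E Pt x2 (- y2) = chord_sum (- m) x3 y3 x2"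
    using slope by (rule ec_add_eq_chord_sum)
  also have "\<dots> = Pt x1 y1" by (simp add: chord_sum_def x3_def y3_def algebra_simps)
  finally show ?thesis using sum chord by simp
qed (use assms in auto)

lemma add_right_cancel:
  assumes "on P" "on Q" "on R" "P \<oplus>\<^sub>E R = Q \<oplus>\<^sub>E R" shows "P = Q"
  using add_neg_cancel assms by metis

end

subsection \<open>Associativity\<close>

text \<open>Three points with slopes \<open>m\<close> of \<open>P\<^sub>1P\<^sub>2\<close> and \<open>m'\<close> of \<open>P\<^sub>2P\<^sub>3\<close>. The two remaining slopes are
  \<open>- m - t\<close> and \<open>- m' - t\<close> for \<open>t = (x\<^sub>1 - x\<^sub>3) / (m' - m)\<close>.\<close>

context
  fixes a m m' x1 y1 x2 y2 x3 y3 x12 y12 x23 y23 :: "'k::field"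
  assumes slopes: "is_slope a m x1 y1 x2 y2" "is_slope a m' x2 y2 x3 y3"
    and sums: "chord_sum m x1 y1 x2 = Pt x12 y12" "chord_sum m' x2 y2 x3 = Pt x23 y23"
begin

private lemma coordinates:
  "x12 = m^2 - x1 - x2" "y12 = m * (x1 - x12) - y1"
  "x23 = m'^2 - x2 - x3" "y23 = m' * (x2 - x23) - y2"
  "y1 = y2 - m * (x2 - x1)" "y3 = y2 + m' * (x3 - x2)"
  using sums is_slope_solved(1)[OF slopes(1)] is_slope_solved(1)[OF slopes(2)]
  by (auto simp: chord_sum_def)

lemma is_slope_difference:
  "2 * y2 * (m' - m) = (x1 - x2) * (x12 - x3) - (x3 - x2) * (x23 - x1)"
proof -
  have "m' * (y2 + y3) - m * (y1 + y2) = (x2^2 + x2*x3 + x3^2) - (x1^2 + x1*x2 + x2^2)"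
    using slopes by (simp add: is_slope_def)
  then show ?thesis
    unfolding coordinates by (simp add: algebra_simps power2_eq_square)
qed

lemma is_slope_distinct:
  assumes "x1 \<noteq> x3" "x12 \<noteq> x3" shows "m \<noteq> m'"
proof
  assume "m = m'"
  then have "(x1 - x2) * (x12 - x3) = (x3 - x2) * (x23 - x1)" "x23 - x1 = x12 - x3"
    using is_slope_difference by (simp_all add: coordinates)
  then have "(x1 - x3) * (x12 - x3) = 0" by (simp add: algebra_simps)
  then show False using assms by simp
qed

lemma is_slope_remaining:
  assumes "m \<noteq> m'" "t * (m' - m) = x1 - x3"
  shows "y3 - y12 = (- m - t) * (x3 - x12)" "y23 - y1 = (- m' - t) * (x23 - x1)"
proof -
  have "(m' - m) * (y3 - y12) - (m' - m) * ((- m - t) * (x3 - x12)) =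
      (2 * y2 * (m' - m) - ((x1 - x2) * (x12 - x3) - (x3 - x2) * (x23 - x1))) +
      (x3 - x12) * (t * (m' - m) - (x1 - x3))"
    unfolding coordinates by Groebner_Basis.algebra
  then show "y3 - y12 = (- m - t) * (x3 - x12)" using assms is_slope_difference by simp
  have "(m' - m) * (y23 - y1) - (m' - m) * ((- m' - t) * (x23 - x1)) =
      - (2 * y2 * (m' - m) - ((x1 - x2) * (x12 - x3) - (x3 - x2) * (x23 - x1))) +
      (x23 - x1) * (t * (m' - m) - (x1 - x3))"
    unfolding coordinates by Groebner_Basis.algebra
  then show "y23 - y1 = (- m' - t) * (x23 - x1)" using assms is_slope_difference by simp
qed

lemma chord_sum_assoc:
  assumes "m \<noteq> m'" "t * (m' - m) = x1 - x3"
  shows "chord_sum (- m' - t) x1 y1 x23 = chord_sum (- m - t) x12 y12 x3"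
proof -
  have "(- m' - t)^2 - x1 - x23 - ((- m - t)^2 - x12 - x3) = 2 * (t * (m' - m) - (x1 - x3))"
    unfolding coordinates by Groebner_Basis.algebra
  then have x_eq: "(- m' - t)^2 - x1 - x23 = (- m - t)^2 - x12 - x3" using assms by simp
  have "(- m' - t) * (x1 - ((- m - t)^2 - x12 - x3)) - y1 -
      ((- m - t) * (x12 - ((- m - t)^2 - x12 - x3)) - y12) =
      (2 * m + t) * (t * (m' - m) - (x1 - x3)) - (y3 - y12 - (- m - t) * (x3 - x12))"
    unfolding coordinates by Groebner_Basis.algebra
  then have "(- m' - t) * (x1 - ((- m - t)^2 - x12 - x3)) - y1 =
      (- m - t) * (x12 - ((- m - t)^2 - x12 - x3)) - y12"
    using assms is_slope_remaining[of t] by simp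
  then show ?thesis unfolding chord_sum_def x_eq by simp
qed

end

context elliptic_curve
begin

lemma add_assoc_generic:
  assumes "on (Pt x1 y1)" "on (Pt x2 y2)" "on (Pt x3 y3)"
    and "x1 \<noteq> x2" "x1 \<noteq> x3" "\<not> (x2 = x3 \<and> y2 = - y3)"
    and sum12: "Pt x1 y1 \<oplus>\<^sub>E Pt x2 y2 = Pt x12 y12" "x12 \<noteq> x3"
    and sum23: "Pt x2 y2 \<oplus>\<^sub>E Pt x3 y3 = Pt x23 y23" "x1 \<noteq> x23"
  shows "Pt x1 y1 \<oplus>\<^sub>E (Pt x2 y2 \<oplus>\<^sub>E Pt x3 y3) = (Pt x1 y1 \<oplus>\<^sub>E Pt x2 y2) \<oplus>\<^sub>E Pt x3 y3"
proof -
  define m m' where "m = ec_slope a x1 y1 x2 y2" and "m' = ec_slope a x2 y2 x3 y3"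
  have slopes: "is_slope a m x1 y1 x2 y2" "is_slope a m' x2 y2 x3 y3"
    unfolding m_def m'_def using assms by (auto intro!: is_slope_ec_slope)
  have sums: "chord_sum m x1 y1 x2 = Pt x12 y12" "chord_sum m' x2 y2 x3 = Pt x23 y23"
    using assms unfolding ec_add_Pt m_def m'_def by auto
  have "m \<noteq> m'" using is_slope_distinct[OF slopes sums] assms by blast
  define t where "t = (x1 - x3) / (m' - m)"
  have t_eq: "t * (m' - m) = x1 - x3" using \<open>m \<noteq> m'\<close> by (simp add: t_def)
  note remaining = is_slope_remaining[OF slopes sums \<open>m \<noteq> m'\<close> t_eq]
  have "ec_slope a x12 y12 x3 y3 = - m - t" "ec_slope a x1 y1 x23 y23 = - m' - t"
    using remaining sum12(2) sum23(2) by (simp_all add: ec_slope_def)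
  then show ?thesis
    using chord_sum_assoc[OF slopes sums \<open>m \<noteq> m'\<close> t_eq] sum12 sum23 by (simp add: ec_add_Pt)
qed

definition points_above :: "'k \<Rightarrow> 'k ec_point set" where
  "points_above x = {P. on P \<and> (\<exists>y. P = Pt x y)}"

lemma finite_points_above: "finite (points_above x)"
proof -
  have "finite {y. poly [:-(x^3 + a*x + b), 0, 1:] y = 0}"
    by (rule poly_roots_finite) simp
  moreover have "points_above x \<subseteq> Pt x ` {y. poly [:-(x^3 + a*x + b), 0, 1:] y = 0}"
    by (auto simp: points_above_def power2_eq_square)
  ultimately show ?thesis by (meson finite_imageI finite_subset)
qed

lemma finite_add_preimage:
  assumes "on Q" "finite Z" shows "finite {S. on S \<and> S \<oplus>\<^sub>E Q \<in> Z}"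
proof (rule finite_subset)
  show "{S. on S \<and> S \<oplus>\<^sub>E Q \<in> Z} \<subseteq> (\<lambda>R. R \<oplus>\<^sub>E ec_neg Q) ` Z"
    using add_neg_cancel[OF _ assms(1)] by (force simp: image_iff)
qed (use assms in simp)

definition assoc_failures :: "'k ec_point \<Rightarrow> 'k ec_point \<Rightarrow> 'k ec_point set" where
  "assoc_failures P Q = {S. on S \<and> S \<oplus>\<^sub>E (P \<oplus>\<^sub>E Q) \<noteq> (S \<oplus>\<^sub>E P) \<oplus>\<^sub>E Q}"

lemma assoc_failures_subset:
  assumes "on (Pt x2 y2)" "on (Pt x3 y3)" "\<not> (x2 = x3 \<and> y2 = - y3)"
    and "Pt x2 y2 \<oplus>\<^sub>E Pt x3 y3 = Pt x23 y23"
  shows "assoc_failures (Pt x2 y2) (Pt x3 y3) \<subseteq>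
    insert Inf (points_above x2 \<union> points_above x3 \<union> points_above x23 \<union>
      {S. on S \<and> S \<oplus>\<^sub>E Pt x2 y2 \<in> insert Inf (points_above x3)})" (is "_ \<subseteq> ?exceptional")
proof (rule subsetI, rule ccontr)
  fix S assume failure: "S \<in> assoc_failures (Pt x2 y2) (Pt x3 y3)" and general: "S \<notin> ?exceptional"
  from failure have "on S" by (simp add: assoc_failures_def)
  obtain x1 y1 where S_eq: "S = Pt x1 y1" using general by (cases S) auto
  obtain x12 y12 where sum12: "S \<oplus>\<^sub>E Pt x2 y2 = Pt x12 y12"
    using general \<open>on S\<close> by (cases "S \<oplus>\<^sub>E Pt x2 y2") auto
  have "on (Pt x12 y12)" using sum12 \<open>on S\<close> assms by (metis on_add)
  then have "x1 \<noteq> x2" "x1 \<noteq> x3" "x12 \<noteq> x3" "x1 \<noteq> x23"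
    using general \<open>on S\<close> sum12 S_eq by (auto simp: points_above_def)
  then have "S \<oplus>\<^sub>E (Pt x2 y2 \<oplus>\<^sub>E Pt x3 y3) = (S \<oplus>\<^sub>E Pt x2 y2) \<oplus>\<^sub>E Pt x3 y3"
    using add_assoc_generic \<open>on S\<close> assms sum12 unfolding S_eq by blast
  then show False using failure by (simp add: assoc_failures_def)
qed

lemma finite_assoc_failures:
  assumes "on P" "on Q" shows "finite (assoc_failures P Q)"
  using assms
proof (cases rule: add_cases)
  case (chord x2 y2 x3 y3 m)
  obtain x23 y23 where "P \<oplus>\<^sub>E Q = Pt x23 y23" using chord(5) by (simp add: chord_sum_def)
  then have "assoc_failures P Q \<subseteq>
    insert Inf (points_above x2 \<union> points_above x3 \<union> points_above x23 \<union>
      {S. on S \<and> S \<oplus>\<^sub>E P \<in> insert Inf (points_above x3)})"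
    using assoc_failures_subset chord assms by blast
  moreover have "finite {S. on S \<and> S \<oplus>\<^sub>E P \<in> insert Inf (points_above x3)}"
    using assms by (intro finite_add_preimage finite.insertI finite_points_above)
  ultimately show ?thesis using finite_points_above by (auto intro: finite_subset)
next
  case opposite
  then have "assoc_failures P Q = {}"
    using add_neg_cancel[OF _ assms(1)] opposite by (auto simp: assoc_failures_def)
  then show ?thesis by simp
qed (simp_all add: assoc_failures_def)

text \<open>Both sides agree after adding a sufficiently general point, which can then be cancelled.\<close>

lemma add_assoc:
  assumes infinite: "infinite {P. on P}" and on: "on P" "on Q" "on R"
  shows "P \<oplus>\<^sub>E (Q \<oplus>\<^sub>E R) = (P \<oplus>\<^sub>E Q) \<oplus>\<^sub>E R"
proof -
  define bad where "bad = assoc_failures P (Q \<oplus>\<^sub>E R) \<union> assoc_failures (P \<oplus>\<^sub>E Q) R \<union>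
    assoc_failures P Q \<union> {S. on S \<and> S \<oplus>\<^sub>E P \<in> assoc_failures Q R}"
  have "finite bad"
    unfolding bad_def using on
    by (intro finite_UnI finite_assoc_failures finite_add_preimage) simp_all
  then have "{P. on P} - bad \<noteq> {}"
    using Diff_infinite_finite[OF _ infinite] infinite_imp_nonempty by blast
  then obtain S where good: "on S" "S \<notin> bad" by auto
  have "S \<oplus>\<^sub>E (P \<oplus>\<^sub>E (Q \<oplus>\<^sub>E R)) = S \<oplus>\<^sub>E P \<oplus>\<^sub>E (Q \<oplus>\<^sub>E R)"
    using good by (auto simp: bad_def assoc_failures_def)
  also have "\<dots> = S \<oplus>\<^sub>E P \<oplus>\<^sub>E Q \<oplus>\<^sub>E R" using good on by (auto simp: bad_def assoc_failures_def)
  also have "\<dots> = S \<oplus>\<^sub>E (P \<oplus>\<^sub>E Q \<oplus>\<^sub>E R)" using good by (auto simp: bad_def assoc_failures_def)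
  finally show ?thesis
    using add_right_cancel[of "P \<oplus>\<^sub>E (Q \<oplus>\<^sub>E R)" "P \<oplus>\<^sub>E Q \<oplus>\<^sub>E R" S] add_commute good on by simp
qed

end

section \<open>Finite subfields in prime characteristic\<close>

lemma degree_monom_1_minus:
  fixes p :: "'a::comm_ring_1 poly"
  assumes "degree p < n" shows "degree (monom 1 n - p) = n"
proof -
  have "degree (monom 1 n + - p) = degree (monom (1::'a) n)"
    using assms by (intro degree_add_eq_left) (simp add: degree_monom_eq)
  then show ?thesis by (simp add: degree_monom_eq)
qed

lemma coeff_power_CHAR:
  fixes G :: "'k::field poly"
  assumes "prime l" "CHAR('k) = l"
  shows "coeff (G ^ l) i = (if l dvd i then coeff G (i div l) ^ l else 0)"
proof -
  have "l > 0" using assms(1) prime_gt_0_nat by blast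
  have "G ^ l = (\<Sum>k\<le>degree G. monom (coeff G k) k) ^ l"
    by (simp add: poly_as_sum_of_monoms)
  also have "\<dots> = (\<Sum>k\<le>degree G. monom (coeff G k) k ^ l)"
    by (rule freshmans_dream_sum) (simp_all add: assms)
  also have "\<dots> = (\<Sum>k\<le>degree G. monom (coeff G k ^ l) (l * k))"
    by (simp add: monom_power mult.commute)
  finally have sum: "coeff (G ^ l) i = (\<Sum>k\<le>degree G. if l * k = i then coeff G k ^ l else 0)"
    by (simp add: coeff_sum)
  show ?thesis
  proof (cases "l dvd i")
    case True
    then obtain k where "i = l * k" by blast
    then show ?thesis
      unfolding sum using \<open>l > 0\<close> coeff_eq_0[of G k] by (auto simp: power_0_left not_le)
  qed (auto simp: sum intro!: sum.neutral)
qed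

text \<open>Modulo \<open>l\<close> the exponents of \<open>G\<^sup>l\<close> are \<open>0\<close>, and \<open>l - 1\<close> is the only exponent of \<open>h\<close> in its
  class.\<close>

lemma coeff_mult_power_CHAR:
  fixes h G :: "'k::field poly"
  assumes "prime l" "CHAR('k) = l" and "degree h < 2 * l - 1"
  shows "coeff (h * G ^ l) (l - 1 + l * k) = coeff h (l - 1) * coeff G k ^ l"
proof -
  let ?N = "l - 1 + l * k"
  have "l > 1" using assms(1) prime_gt_1_nat by blast
  have "coeff (h * G ^ l) ?N = (\<Sum>i\<le>?N. coeff h i * coeff (G ^ l) (?N - i))"
    by (rule coeff_mult)
  also have "\<dots> = (\<Sum>i\<in>{l - 1}. coeff h i * coeff (G ^ l) (?N - i))"
  proof (rule sum.mono_neutral_right)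
    show "\<forall>i\<in>{..?N} - {l - 1}. coeff h i * coeff (G ^ l) (?N - i) = 0"
    proof
      fix i assume range: "i \<in> {..?N} - {l - 1}"
      show "coeff h i * coeff (G ^ l) (?N - i) = 0"
      proof (cases "i \<le> degree h \<and> l dvd ?N - i")
        case True
        then obtain c where "?N - i = l * c" by blast
        then have "i + l * c = l - 1 + l * k" using range by auto
        then have "i mod l = (l - 1) mod l" by (metis mod_mult_self2)
        then have "i mod l = l - 1" using \<open>l > 1\<close> by simp
        moreover have "i < 2 * l - 1" using True assms(3) by simp
        ultimately have "i = l - 1"
          using \<open>l > 1\<close> by (cases "i < l") (auto simp: mod_if split: if_splits)
        then show ?thesis using range by simp
      next
        case False
        then show ?thesis
          using coeff_eq_0[of h i] coeff_power_CHAR[OF assms(1,2), of G] by auto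
      qed
    qed
  qed auto
  also have "\<dots> = coeff h (l - 1) * coeff G k ^ l"
    using coeff_power_CHAR[OF assms(1,2), of G] \<open>l > 1\<close> by simp
  finally show ?thesis .
qed

locale prime_char_field =
  fixes K :: "'k::field itself" and l :: nat
  assumes prime_l: "prime l" and CHAR_eq: "CHAR('k) = l"
begin

lemma l_gt_1: "l > 1" using prime_l prime_gt_1_nat by blast

lemma of_nat_l [simp]: "of_nat l = (0::'k)" using CHAR_eq of_nat_CHAR by metis

lemma of_nat_eq_0_iff_dvd: "of_nat m = (0::'k) \<longleftrightarrow> l dvd m"
  using of_nat_eq_0_iff_char_dvd CHAR_eq by metis

lemma of_nat_prime_nonzero:
  assumes "prime p" "p \<noteq> l" shows "of_nat p \<noteq> (0::'k)"
  using assms prime_l primes_dvd_imp_eq by (auto simp: of_nat_eq_0_iff_dvd)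

lemma two_nonzero_if_odd: "l \<noteq> 2 \<Longrightarrow> (2::'k) \<noteq> 0"
  using of_nat_prime_nonzero[of 2] by simp

lemma odd_power_l: "l \<noteq> 2 \<Longrightarrow> odd (l^n)"
  using prime_l prime_odd_nat[of l] l_gt_1 by auto

lemma twice_half_q_minus_1: "l \<noteq> 2 \<Longrightarrow> 2 * ((l^n - 1) div 2) = l^n - 1"
  using odd_power_l[of n] by simp

lemma q_gt_1: "n > 0 \<Longrightarrow> l^n > 1"
  using l_gt_1 by (rule one_less_power)

definition frob :: "nat \<Rightarrow> 'k \<Rightarrow> 'k" where "frob n x = x ^ (l^n)"

sublocale frob: field_hom "frob n" for n
  using freshmans_dream'[of "l^n" n] prime_l CHAR_eq l_gt_1
  by unfold_locales (auto simp: frob_def power_mult_distrib power_0_left)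

definition Fq :: "nat \<Rightarrow> 'k set" where "Fq n = {x. frob n x = x}"

lemma Fq_0 [simp]: "0 \<in> Fq n" and Fq_1 [simp]: "1 \<in> Fq n"
  by (simp_all add: Fq_def)

lemma Fq_of_nat [simp]: "of_nat m \<in> Fq n" and Fq_numeral [simp]: "numeral w \<in> Fq n"
  by (simp_all add: Fq_def frob.hom_of_nat frob.hom_numeral)

lemma Fq_closed [intro]:
  shows Fq_uminus: "x \<in> Fq n \<Longrightarrow> - x \<in> Fq n"
    and Fq_add: "x \<in> Fq n \<Longrightarrow> y \<in> Fq n \<Longrightarrow> x + y \<in> Fq n"
    and Fq_diff: "x \<in> Fq n \<Longrightarrow> y \<in> Fq n \<Longrightarrow> x - y \<in> Fq n"
    and Fq_mult: "x \<in> Fq n \<Longrightarrow> y \<in> Fq n \<Longrightarrow> x * y \<in> Fq n"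
    and Fq_divide: "x \<in> Fq n \<Longrightarrow> y \<in> Fq n \<Longrightarrow> x / y \<in> Fq n"
    and Fq_power: "x \<in> Fq n \<Longrightarrow> x ^ m \<in> Fq n"
  by (simp_all add: Fq_def hom_distribs)

lemma Fq_1_subset: "Fq 1 \<subseteq> Fq n"
  by (induction n) (auto simp: Fq_def frob_def power_mult)

lemma Fq_power_minus_1:
  assumes "x \<in> Fq n" "x \<noteq> 0" shows "x ^ (l^n - 1) = 1"
proof -
  have "x ^ (l^n - 1) * x = x"
    using assms l_gt_1 by (simp add: Fq_def frob_def flip: power_Suc2)
  then show ?thesis using assms by simp
qed

lemma bij_betw_power_Fq:
  assumes "m > 0" "coprime m (l^n - 1)" shows "bij_betw (\<lambda>x. x^m) (Fq n) (Fq n)"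
proof -
  obtain d u v where d_dvd: "d dvd m" "d dvd l^n - 1" and "m * u = (l^n - 1) * v + d"
    using bezout_add_strong_nat[of m "l^n - 1"] assms(1) by auto
  moreover have "d = 1" using d_dvd assms(2) coprime_common_divisor_nat by blast
  ultimately have "m * u = (l^n - 1) * v + 1" by simp
  then have "x ^ (m * u) = x" if "x \<in> Fq n" for x
    using Fq_power_minus_1[OF that] by (cases "x = 0") (simp_all add: power_add power_mult)
  then have "(x^m)^u = x" "(x^u)^m = x" if "x \<in> Fq n" for x
    using that by (metis power_mult, metis power_mult mult.commute)
  then show ?thesis
    by (intro bij_betwI[where g = "\<lambda>x. x^u"]) auto
qed

lemma four_dvd_if_minus_1_square:
  assumes "l \<noteq> 2" "t \<in> Fq n" "t^2 + 1 = 0" shows "4 dvd l^n - 1"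
proof -
  have "t \<noteq> 0" "t^2 = - 1" using assms(3) by (auto simp: eq_neg_iff_add_eq_0)
  obtain m where half: "l^n - 1 = 2 * m" using twice_half_q_minus_1[OF assms(1)] by metis
  have "(- 1) ^ m = (1::'k)"
    using Fq_power_minus_1[OF assms(2) \<open>t \<noteq> 0\<close>] \<open>t^2 = - 1\<close> unfolding half power_mult by simp
  moreover have "(- 1 :: 'k) \<noteq> 1"
    using two_nonzero_if_odd[OF assms(1)] by (simp add: neg_eq_iff_add_eq_0)
  ultimately have "even m" by (metis neg_one_odd_power)
  then show ?thesis using half by auto
qed

definition frob_poly :: "nat \<Rightarrow> 'k poly" where "frob_poly n = monom 1 (l^n) - [:0, 1:]"

lemma poly_frob_poly: "poly (frob_poly n) x = 0 \<longleftrightarrow> x \<in> Fq n"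
  by (simp add: frob_poly_def Fq_def frob_def poly_monom)

lemma degree_frob_poly: "n > 0 \<Longrightarrow> degree (frob_poly n) = l^n"
  using q_gt_1[of n] by (simp add: frob_poly_def degree_monom_1_minus)

lemma frob_poly_nonzero: "n > 0 \<Longrightarrow> frob_poly n \<noteq> 0"
  using degree_frob_poly q_gt_1 by (metis degree_0 not_one_less_zero)

lemma pderiv_frob_poly: "n > 0 \<Longrightarrow> pderiv (frob_poly n) = - 1"
  by (simp add: frob_poly_def pderiv_diff pderiv_monom pderiv_pCons power_0_left one_pCons)

lemma finite_Fq: "n > 0 \<Longrightarrow> finite (Fq n)"
  using poly_roots_finite[OF frob_poly_nonzero] by (simp add: poly_frob_poly)

end

section \<open>Finite subfields of an algebraically closed field\<close>

locale alg_closed_prime_char_field = prime_char_field K l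
  for K :: "'k::field itself" and l :: nat +
  assumes closed: "\<And>p::'k poly. degree p > 0 \<Longrightarrow> \<exists>x. poly p x = 0"
begin

lemma card_roots_separable:
  fixes p :: "'k poly"
  assumes "p \<noteq> 0" "\<And>x. poly p x = 0 \<Longrightarrow> poly (pderiv p) x \<noteq> 0"
  shows "card {x. poly p x = 0} = degree p"
  using assms
proof (induction "degree p" arbitrary: p rule: less_induct)
  case less
  show ?case
  proof (cases "degree p = 0")
    case True
    then obtain c where "p = [:c:]" by (metis degree_eq_zeroE)
    with less.prems(1) show ?thesis by simp
  next
    case False
    then obtain c where "poly p c = 0" using closed by blast
    then obtain q where p_eq: "p = [:-c, 1:] * q" by (metis dvdE poly_eq_0_iff_dvd)
    have "q \<noteq> 0" using p_eq less.prems(1) by auto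
    then have degree_p: "degree p = Suc (degree q)" unfolding p_eq by (subst degree_mult_eq) auto
    have deriv: "poly (pderiv p) x = poly q x + (x - c) * poly (pderiv q) x" for x
      unfolding p_eq pderiv_mult by (simp add: pderiv_pCons algebra_simps)
    have "poly q c \<noteq> 0" using less.prems(2)[of c] deriv[of c] \<open>poly p c = 0\<close> by simp
    moreover have "card {x. poly q x = 0} = degree q"
    proof (rule less.hyps)
      show "poly (pderiv q) x \<noteq> 0" if "poly q x = 0" for x
        using less.prems(2)[of x] deriv[of x] that by (auto simp: p_eq)
    qed (use degree_p \<open>q \<noteq> 0\<close> in auto)
    moreover have "{x. poly p x = 0} = insert c {x. poly q x = 0}" by (auto simp: p_eq)
    ultimately show ?thesis using degree_p poly_roots_finite[OF \<open>q \<noteq> 0\<close>] by simp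
  qed
qed

lemma nth_root_exists:
  assumes "n > 0" shows "\<exists>u::'k. u^n = c"
proof -
  have "degree (monom 1 n - [:c:]) = n" using assms by (simp add: degree_monom_1_minus)
  then obtain u where "poly (monom 1 n - [:c:]) u = 0" using closed assms by metis
  then show ?thesis by (auto simp: poly_monom)
qed

lemma card_nth_roots:
  assumes "of_nat n \<noteq> (0::'k)" "c \<noteq> 0"
  shows "finite {u::'k. u^n = c}" "card {u::'k. u^n = c} = n"
proof -
  let ?p = "monom 1 n - [:c:]"
  have "n > 0" using assms(1) by (metis not_gr_zero of_nat_0)
  then have deg: "degree ?p = n" by (simp add: degree_monom_1_minus)
  then have "?p \<noteq> 0" using \<open>n > 0\<close> by force
  have root: "poly ?p u = 0 \<longleftrightarrow> u^n = c" for u by (simp add: poly_monom)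
  show "finite {u::'k. u^n = c}" using poly_roots_finite[OF \<open>?p \<noteq> 0\<close>] unfolding root .
  have "poly (pderiv ?p) u \<noteq> 0" if "poly ?p u = 0" for u
    using that assms \<open>n > 0\<close> unfolding root
    by (auto simp: pderiv_diff pderiv_monom pderiv_pCons poly_monom power_0_left)
  then show "card {u::'k. u^n = c} = n"
    using card_roots_separable[OF \<open>?p \<noteq> 0\<close>] deg unfolding root by simp
qed

lemma card_Fq:
  assumes "n > 0" shows "card (Fq n) = l^n"
proof -
  have "card {x. poly (frob_poly n) x = 0} = l^n"
    using card_roots_separable[OF frob_poly_nonzero] pderiv_frob_poly degree_frob_poly assms by simp
  then show ?thesis by (simp add: poly_frob_poly)
qed

lemma poly_eq_0_if_zero_on_Fq:
  fixes p :: "'k poly"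
  assumes "n > 0" "degree p < l^n" "\<And>x. x \<in> Fq n \<Longrightarrow> poly p x = 0"
  shows "p = 0"
  using assms card_Fq l_gt_1 by (intro poly_eqI_degree[of "Fq n" p 0]) auto

lemma frob_poly_dvd_if_zero_on_Fq:
  fixes p :: "'k poly"
  assumes "n > 0" "\<And>x. x \<in> Fq n \<Longrightarrow> poly p x = 0"
  shows "frob_poly n dvd p"
proof -
  have "poly (p mod frob_poly n) x = 0" if "x \<in> Fq n" for x
  proof -
    have "poly p x = poly (p div frob_poly n) x * poly (frob_poly n) x + poly (p mod frob_poly n) x"
      by (metis div_mult_mod_eq poly_add poly_mult)
    then show ?thesis using assms(2)[OF that] that poly_frob_poly[of n x] by simp
  qed
  moreover have "degree (p mod frob_poly n) < l^n"
    using degree_mod_less[OF frob_poly_nonzero[OF assms(1)], of p]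
      degree_frob_poly[OF assms(1)] l_gt_1
    by auto
  ultimately show ?thesis
    using poly_eq_0_if_zero_on_Fq assms(1) mod_eq_0_iff_dvd by blast
qed

subsection \<open>Power sums and squares\<close>

lemma ex_power_neq_1_Fq:
  assumes "n > 0" "0 < i" "i < l^n - 1" shows "\<exists>g\<in>Fq n. g \<noteq> 0 \<and> g^i \<noteq> 1"
proof (rule ccontr)
  assume all_roots: "\<not> ?thesis"
  have deg: "degree (monom 1 i - 1 :: 'k poly) = i"
    using assms(2) by (simp add: degree_monom_1_minus)
  then have nonzero: "monom 1 i - 1 \<noteq> (0::'k poly)" using assms(2) by force
  have "Fq n - {0} \<subseteq> {x. poly (monom 1 i - 1) x = 0}"
    using all_roots by (auto simp: poly_monom)
  then have "card (Fq n - {0}) \<le> card {x. poly (monom 1 i - 1 :: 'k poly) x = 0}"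
    using poly_roots_finite[OF nonzero] card_mono by blast
  also have "\<dots> \<le> i" using card_poly_roots_bound[OF nonzero] deg by simp
  finally show False using assms finite_Fq card_Fq by simp
qed

lemma sum_power_Fq_eq_0:
  assumes "n > 0" "0 < i" "i < l^n - 1" shows "(\<Sum>x\<in>Fq n. x^i) = 0"
proof -
  obtain g where g_power: "g \<in> Fq n" "g \<noteq> 0" "g^i \<noteq> 1" using ex_power_neq_1_Fq[OF assms] by blast
  have "(\<Sum>x\<in>Fq n. x^i) = (\<Sum>x\<in>Fq n. (g*x)^i)"
    by (rule sum.reindex_bij_witness[of _ "\<lambda>x. g*x" "\<lambda>x. x/g"]) (use g_power in auto)
  also have "\<dots> = g^i * (\<Sum>x\<in>Fq n. x^i)"
    by (simp add: power_mult_distrib sum_distrib_left)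
  finally have "(1 - g^i) * (\<Sum>x\<in>Fq n. x^i) = 0" by (simp add: algebra_simps)
  then show ?thesis using g_power by simp
qed

lemma sum_power_Fq:
  assumes "n > 0" "l \<noteq> 2" "i < 2 * (l^n - 1)"
  shows "(\<Sum>x\<in>Fq n. x^i) = (if i = l^n - 1 then - 1 else 0)"
proof -
  note fin = finite_Fq[OF \<open>n > 0\<close>] card_Fq[OF \<open>n > 0\<close>]
  note q = q_gt_1[OF \<open>n > 0\<close>]
  consider (zero) "i = 0" | (below) "0 < i" "i < l^n - 1"
    | (equal) "i = l^n - 1" | (above) "i > l^n - 1"
    by linarith
  then show ?thesis
  proof cases
    case zero
    then show ?thesis using fin q assms by simp
  next
    case below
    then show ?thesis using sum_power_Fq_eq_0 assms by simp
  next
    case equal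
    then have "(\<Sum>x\<in>Fq n. x^i) = (\<Sum>x\<in>Fq n - {0}. x^i)"
      using fin q by (subst sum.remove[of _ 0]) (auto simp: power_0_left)
    also have "\<dots> = (\<Sum>x\<in>Fq n - {0}. 1)"
      by (rule sum.cong) (use equal Fq_power_minus_1 in auto)
    also have "\<dots> = of_nat (l^n) - 1" using fin q by (simp add: of_nat_diff)
    finally show ?thesis using assms equal by simp
  next
    case above
    define k where "k = i - l^n"
    have i_eq: "i = l^n + k" using above by (simp add: k_def)
    have "(\<Sum>x\<in>Fq n. x^i) = (\<Sum>x\<in>Fq n. x^(Suc k))"
      by (rule sum.cong) (auto simp: i_eq power_add Fq_def frob_def)
    also have "\<dots> = 0" using assms i_eq by (intro sum_power_Fq_eq_0) auto
    finally show ?thesis using above by simp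
  qed
qed

lemma sum_poly_Fq:
  fixes p :: "'k poly"
  assumes "n > 0" "l \<noteq> 2" "degree p < 2 * (l^n - 1)"
  shows "(\<Sum>x\<in>Fq n. poly p x) = - coeff p (l^n - 1)"
proof -
  have "(\<Sum>x\<in>Fq n. poly p x) = (\<Sum>i\<le>degree p. coeff p i * (\<Sum>x\<in>Fq n. x^i))"
    unfolding poly_altdef by (subst sum.swap) (simp add: sum_distrib_left)
  also have "\<dots> = (\<Sum>i\<le>degree p. if i = l^n - 1 then - coeff p i else 0)"
    by (rule sum.cong) (use assms in \<open>auto simp: sum_power_Fq\<close>)
  also have "\<dots> = - coeff p (l^n - 1)"
    using coeff_eq_0[of p "l^n - 1"] by (auto simp: sum.delta)
  finally show ?thesis .
qed

definition sqrts :: "nat \<Rightarrow> 'k \<Rightarrow> 'k set" where "sqrts n c = {y \<in> Fq n. y^2 = c}"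

definition quad_char :: "nat \<Rightarrow> 'k \<Rightarrow> 'k" where "quad_char n c = c ^ ((l^n - 1) div 2)"

lemma quad_char_square: "l \<noteq> 2 \<Longrightarrow> quad_char n (y^2) = y ^ (l^n - 1)"
  unfolding quad_char_def by (metis power_mult twice_half_q_minus_1)

lemma quad_char_cases:
  assumes "l \<noteq> 2" "c \<in> Fq n" "c \<noteq> 0" shows "quad_char n c = 1 \<or> quad_char n c = - 1"
proof -
  have "(quad_char n c)^2 = quad_char n (c^2)"
    unfolding quad_char_def by (metis power_mult mult.commute)
  then show ?thesis
    using quad_char_square[OF assms(1)] Fq_power_minus_1[OF assms(2,3)]
    by (simp add: power2_eq_1_iff)
qed

lemma euler_criterion:
  assumes "l \<noteq> 2" "c \<noteq> 0" shows "sqrts n c \<noteq> {} \<longleftrightarrow> quad_char n c = 1"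
proof
  assume "sqrts n c \<noteq> {}"
  then obtain y where "y \<in> Fq n" "c = y^2" by (auto simp: sqrts_def)
  then show "quad_char n c = 1"
    using quad_char_square[OF assms(1)] Fq_power_minus_1 assms(2) by auto
next
  assume "quad_char n c = 1"
  obtain y where y_sq: "y^2 = c" using nth_root_exists[of 2] by auto
  then have "y ^ (l^n - 1) = 1" using \<open>quad_char n c = 1\<close> quad_char_square[OF assms(1)] by metis
  then have "y ^ (l^n) = y" 
    using l_gt_1 power_minus_mult[of "l^n" y] by simp
  then show "sqrts n c \<noteq> {}" using y_sq by (auto simp: sqrts_def Fq_def frob_def)
qed

lemma card_sqrts:
  assumes "n > 0" "l \<noteq> 2" "c \<in> Fq n"
  shows "of_nat (card (sqrts n c)) = 1 + quad_char n c"
proof -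
  consider (zero) "c = 0" | (square) "c \<noteq> 0" "quad_char n c = 1"
    | (nonsquare) "c \<noteq> 0" "quad_char n c = - 1"
    using quad_char_cases assms by blast
  then show ?thesis
  proof cases
    case zero
    then have "sqrts n c = {0}" by (auto simp: sqrts_def)
    moreover have "(l^n - 1) div 2 > 0"
      using q_gt_1[OF assms(1)] twice_half_q_minus_1[OF assms(2), of n] by linarith
    ultimately show ?thesis using zero by (simp add: quad_char_def power_0_left)
  next
    case square
    then obtain y where root: "y \<in> Fq n" "y^2 = c"
      using euler_criterion assms(2) by (auto simp: sqrts_def)
    then have "sqrts n c = {y, - y}" by (auto simp: sqrts_def power2_eq_iff)
    moreover have "y \<noteq> - y"
      using root square two_nonzero_if_odd[OF assms(2)]
      by (auto simp: eq_neg_iff_add_eq_0 simp flip: mult_2)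
    ultimately show ?thesis using square by simp
  next
    case nonsquare
    then have "quad_char n c \<noteq> 1"
      using two_nonzero_if_odd[OF assms(2)] by (simp add: neg_eq_iff_add_eq_0)
    then have "sqrts n c = {}" using euler_criterion assms(2) nonsquare by blast
    then show ?thesis using nonsquare by simp
  qed
qed

lemma card_sqrts_le_2: "card (sqrts n c) \<le> 2"
proof -
  have "sqrts n c \<subseteq> {y. poly [:- c, 0, 1:] y = 0}" by (auto simp: sqrts_def power2_eq_square)
  then have "card (sqrts n c) \<le> card {y. poly [:- c, 0, 1:] y = 0}"
    by (intro card_mono poly_roots_finite) auto
  also have "\<dots> \<le> 2" using card_poly_roots_bound[of "[:- c, 0, 1:]"] by simp
  finally show ?thesis .
qed

lemma power_const_on_prime_field:
  assumes l_eq: "l = 2 * m + 1" and m_pos: "m > 0"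
    and factorization: "f^m - [:e:] = frob_poly 1 * u"
    and x_Fq: "x \<in> Fq 1"
  shows "2 * (poly f x * poly u x) = e * poly (pderiv f) x"
proof -
  have frob_poly_0: "poly (frob_poly 1) x = 0" using x_Fq poly_frob_poly by blast
  have "pderiv (f^m) = pderiv (f^m - [:e:])" by (simp add: pderiv_diff pderiv_pCons)
  also have "\<dots> = - u + frob_poly 1 * pderiv u"
    unfolding factorization pderiv_mult using pderiv_frob_poly[of 1] by (simp add: mult.commute)
  finally have "poly (pderiv (f^m)) x = - poly u x" using frob_poly_0 by simp
  moreover have "f * pderiv (f^m) = smult (of_nat m) (f^m * pderiv f)"
    using m_pos by (cases m) (simp_all only: pderiv_power_Suc, simp_all add: mult_ac)
  then have "poly f x * poly (pderiv (f^m)) x = of_nat m * (poly f x ^ m * poly (pderiv f) x)"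
    by (metis poly_mult poly_smult poly_power)
  moreover have "poly f x ^ m = e"
    using arg_cong[OF factorization, of "\<lambda>p. poly p x"] frob_poly_0 by simp
  ultimately have product: "- (poly f x * poly u x) = of_nat m * (e * poly (pderiv f) x)" by simp
  have "- (2 * of_nat m) = (1::'k)"
    using of_nat_l unfolding l_eq by (simp add: add_eq_0_iff2)
  moreover have "2 * (poly f x * poly u x) = - (2 * (- (poly f x * poly u x)))" by simp
  ultimately show ?thesis
    unfolding product by (metis mult.assoc mult_1 mult_minus_left)
qed

text \<open>Otherwise \<open>f\<^sup>m - e = (x\<^sup>l - x) u\<close> with \<open>m = (l - 1) / 2\<close>; differentiating gives \<open>2 f u = e f'\<close>
  on the prime field and hence, by degrees, identically.\<close>

lemma quad_char_cubic_not_constant: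
  assumes "degree f = 3" "l > 3"
  shows "\<not> (\<forall>x\<in>Fq 1. quad_char 1 (poly f x) = e)"
proof
  assume const: "\<forall>x\<in>Fq 1. quad_char 1 (poly f x) = e"
  define m where "m = (l - 1) div 2"
  have l_eq: "l = 2 * m + 1" and m_gt_1: "m > 1"
    using odd_power_l[of 1] assms(2) by (auto simp: m_def elim!: oddE)
  have "frob_poly 1 dvd f^m - [:e:]"
    using const by (intro frob_poly_dvd_if_zero_on_Fq) (auto simp: quad_char_def m_def)
  then obtain u where factorization: "f^m - [:e:] = frob_poly 1 * u" by blast
  have "f \<noteq> 0" using assms(1) by auto
  have degree_power: "degree (f^m - [:e:]) = 3 * m"
    unfolding diff_conv_add_uminus using m_gt_1 assms(1) \<open>f \<noteq> 0\<close>
    by (subst degree_add_eq_left) (simp_all add: degree_power_eq)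
  then have "f^m - [:e:] \<noteq> 0" using m_gt_1 by force
  then have "u \<noteq> 0" using factorization by auto
  then have degree_u: "degree u + l = 3 * m"
    using degree_power factorization frob_poly_nonzero[of 1] degree_frob_poly[of 1]
    by (simp add: degree_mult_eq)
  have degree_fu: "degree (smult 2 (f * u)) = 3 + degree u"
    using two_nonzero_if_odd assms \<open>f \<noteq> 0\<close> \<open>u \<noteq> 0\<close> by (simp add: degree_mult_eq)
  have degree_df: "degree (smult e (pderiv f)) \<le> 2"
    using degree_smult_le[of e "pderiv f"] degree_pderiv_le[of f] assms(1) by simp
  have "smult 2 (f * u) - smult e (pderiv f) = 0"
  proof (rule poly_eq_0_if_zero_on_Fq[of 1])
    show "degree (smult 2 (f * u) - smult e (pderiv f)) < l^1"
      using degree_fu degree_df degree_u l_eq m_gt_1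
      by (intro le_less_trans[OF degree_diff_le_max]) simp
  qed (use power_const_on_prime_field[OF l_eq _ factorization] m_gt_1 in auto)
  then show False using degree_fu degree_df by simp
qed

end

section \<open>Rational points and the Hasse invariant\<close>

locale elliptic_curve_over_prime_field = alg_closed_prime_char_field K l + elliptic_curve a b
  for K :: "'k::field itself" and l :: nat and a b :: 'k +
  assumes coeffs: "a \<in> Fq 1" "b \<in> Fq 1" and l_gt_3: "l > 3"
begin

lemma l_ne_2: "l \<noteq> 2" using l_gt_3 by simp

lemma infinite_on: "infinite {P. on P}"
proof
  assume finite: "finite {P. on P}"
  have sqrt_exists: "\<exists>y. y^2 = c" for c :: 'k using nth_root_exists[of 2] by auto
  then have "range (\<lambda>x. Pt x (SOME y. y^2 = x^3 + a*x + b)) \<subseteq> {P. on P}"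
    using someI_ex[OF sqrt_exists] by auto
  then have "finite (UNIV :: 'k set)"
    using finite by (metis (mono_tags, lifting) ec_point.inject finite_subset finite_imageD injI)
  then have "card (Fq n) \<le> card (UNIV :: 'k set)" for n
    by (simp add: card_mono)
  from this[of "card (UNIV :: 'k set)"]
  have "l ^ card (UNIV :: 'k set) \<le> card (UNIV :: 'k set)"
    using \<open>finite (UNIV :: 'k set)\<close> by (simp add: card_Fq card_gt_0_iff)
  then show False using power_gt_expt[of l "card (UNIV :: 'k set)"] l_gt_1 by simp
qed

definition rational :: "nat \<Rightarrow> 'k ec_point \<Rightarrow> bool" where
  "rational n P = (case P of Inf \<Rightarrow> True | Pt x y \<Rightarrow> x \<in> Fq n \<and> y \<in> Fq n)"

lemma rational_simps [simp]:
  "rational n Inf" "rational n (Pt x y) \<longleftrightarrow> x \<in> Fq n \<and> y \<in> Fq n"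
  by (simp_all add: rational_def)

lemma coeffs_Fq: "a \<in> Fq n" "b \<in> Fq n" using coeffs Fq_1_subset by auto

lemma rational_neg: "rational n P \<Longrightarrow> rational n (ec_neg P)"
  by (cases P) auto

lemma rational_add:
  assumes "rational n P" "rational n Q" shows "rational n (P \<oplus>\<^sub>E Q)"
proof (cases P; cases Q)
  fix x1 y1 x2 y2 assume points: "P = Pt x1 y1" "Q = Pt x2 y2"
  then have "ec_slope a x1 y1 x2 y2 \<in> Fq n"
    using assms coeffs_Fq by (auto simp: ec_slope_def intro!: Fq_closed)
  then show ?thesis
    using assms points by (auto simp: ec_add_Pt chord_sum_def intro!: Fq_closed)
qed (use assms in auto)

definition point_group :: "nat \<Rightarrow> 'k ec_point monoid" where
  "point_group n = \<lparr>carrier = {P. on P \<and> rational n P}, monoid.mult = ec_add a, one = Inf\<rparr>"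

lemma carrier_point_group: "carrier (point_group n) = {P. on P \<and> rational n P}"
  by (simp add: point_group_def)

lemma comm_group_point_group: "comm_group (point_group n)"
proof (rule comm_groupI)
  fix P Q R
  assume "P \<in> carrier (point_group n)" "Q \<in> carrier (point_group n)" "R \<in> carrier (point_group n)"
  then show "P \<otimes>\<^bsub>point_group n\<^esub> Q \<otimes>\<^bsub>point_group n\<^esub> R =
      P \<otimes>\<^bsub>point_group n\<^esub> (Q \<otimes>\<^bsub>point_group n\<^esub> R)"
    using add_assoc[OF infinite_on] by (simp add: point_group_def)
next
  fix P assume "P \<in> carrier (point_group n)"
  then show "\<exists>Q\<in>carrier (point_group n). Q \<otimes>\<^bsub>point_group n\<^esub> P = \<one>\<^bsub>point_group n\<^esub>"
    by (intro bexI[of _ "ec_neg P"]) (auto simp: point_group_def rational_neg)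
qed (auto simp: point_group_def rational_add add_commute)

lemma nat_pow_point_group:
  assumes "P \<in> carrier (point_group n)" shows "P [^]\<^bsub>point_group n\<^esub> (m::nat) = ec_mult a m P"
proof -
  interpret comm_group "point_group n" by (rule comm_group_point_group)
  show ?thesis
  proof (induction m)
    case 0
    then show ?case by (simp add: point_group_def)
  next
    case (Suc m)
    have "P [^]\<^bsub>point_group n\<^esub> Suc m = P \<otimes>\<^bsub>point_group n\<^esub> P [^]\<^bsub>point_group n\<^esub> m"
      using assms by (rule nat_pow_Suc2)
    then show ?case using Suc by (simp add: point_group_def)
  qed
qed

definition cubic :: "'k poly" where "cubic = [:b, a, 0, 1:]"

lemma poly_cubic: "poly cubic x = x^3 + a*x + b"
  by (simp add: cubic_def algebra_simps power3_eq_cube)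

lemma degree_cubic: "degree cubic = 3"
  by (simp add: cubic_def)

lemma poly_cubic_Fq: "x \<in> Fq n \<Longrightarrow> poly cubic x \<in> Fq n"
  using coeffs_Fq by (auto simp: poly_cubic intro!: Fq_closed)

lemma carrier_point_group_eq:
  "carrier (point_group n) =
    insert Inf ((\<lambda>(x, y). Pt x y) ` (SIGMA x:Fq n. sqrts n (poly cubic x)))"
proof (intro equalityI subsetI)
  fix P assume "P \<in> carrier (point_group n)"
  then show "P \<in> insert Inf ((\<lambda>(x, y). Pt x y) ` (SIGMA x:Fq n. sqrts n (poly cubic x)))"
    by (cases P) (auto simp: carrier_point_group sqrts_def poly_cubic image_iff)
qed (auto simp: carrier_point_group sqrts_def poly_cubic)

lemma card_point_group:
  assumes "n > 0"
  shows "finite (carrier (point_group n))"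
    and "card (carrier (point_group n)) = Suc (\<Sum>x\<in>Fq n. card (sqrts n (poly cubic x)))"
proof -
  let ?affine = "SIGMA x:Fq n. sqrts n (poly cubic x)"
  have finite_sqrts: "finite (sqrts n c)" for c
    using finite_Fq[OF assms] by (simp add: sqrts_def)
  then have finite_affine: "finite ?affine" using finite_Fq[OF assms] by (intro finite_SigmaI) auto
  then show "finite (carrier (point_group n))" unfolding carrier_point_group_eq by blast
  have "inj_on (\<lambda>(x, y). Pt x y) ?affine" by (auto simp: inj_on_def)
  then have "card ((\<lambda>(x, y). Pt x y) ` ?affine) = card ?affine" by (rule card_image)
  also have "\<dots> = (\<Sum>x\<in>Fq n. card (sqrts n (poly cubic x)))"
    using finite_Fq[OF assms] finite_sqrts by (subst card_SigmaI) auto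
  finally show "card (carrier (point_group n)) = Suc (\<Sum>x\<in>Fq n. card (sqrts n (poly cubic x)))"
    unfolding carrier_point_group_eq using finite_affine by (subst card_insert_disjoint) auto
qed

lemma torsion_point_exists:
  assumes "n > 0" "prime p" "p dvd card (carrier (point_group n))"
  shows "\<exists>P\<in>carrier (point_group n). P \<noteq> Inf \<and> ec_mult a p P = Inf"
proof -
  interpret comm_group "point_group n" by (rule comm_group_point_group)
  obtain m where "Coset.order (point_group n) = p^1 * m"
    using assms(3) by (auto simp: Coset.order_def)
  then obtain H where sylow_subgroup: "subgroup H (point_group n)" "card H = p"
    using sylow_thm[OF assms(2) is_group] card_point_group(1)[OF assms(1)] by fastforce
  have "\<not> H \<subseteq> {Inf}"
    using card_mono[of "{Inf}" H] sylow_subgroup(2) prime_gt_1_nat[OF assms(2)] by auto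
  then obtain P where P_in_H: "P \<in> H" "P \<noteq> Inf" by auto
  then have P_carrier: "P \<in> carrier (point_group n)"
    using sylow_subgroup(1) subgroup.mem_carrier by fastforce
  interpret H: group "point_group n\<lparr>carrier := H\<rparr>"
    using sylow_subgroup(1) by (rule subgroup_imp_group)
  have "P [^]\<^bsub>point_group n\<lparr>carrier := H\<rparr>\<^esub> p = \<one>\<^bsub>point_group n\<lparr>carrier := H\<rparr>\<^esub>"
    using H.pow_order_eq_1[of P] P_in_H sylow_subgroup(2) by (simp add: Coset.order_def)
  then have "P [^]\<^bsub>point_group n\<^esub> p = \<one>\<^bsub>point_group n\<^esub>"
    using nat_pow_consistent by simp
  then have "ec_mult a p P = Inf"
    using nat_pow_point_group[OF P_carrier] by (simp add: point_group_def)
  then show ?thesis using P_carrier P_in_H by blast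
qed

definition hasse :: "nat \<Rightarrow> 'k" where
  "hasse n = coeff (cubic ^ ((l^n - 1) div 2)) (l^n - 1)"

lemma degree_cubic_power: "degree (cubic ^ m) = 3 * m"
  using degree_power_eq[of cubic m] degree_cubic by force

lemma of_nat_card_point_group:
  assumes "n > 0" shows "of_nat (card (carrier (point_group n))) = 1 - hasse n"
proof -
  have "of_nat (card (carrier (point_group n))) =
      1 + (\<Sum>x\<in>Fq n. of_nat (card (sqrts n (poly cubic x))) :: 'k)"
    using card_point_group(2)[OF assms] by simp
  also have "(\<Sum>x\<in>Fq n. of_nat (card (sqrts n (poly cubic x))) :: 'k) =
      (\<Sum>x\<in>Fq n. 1 + poly (cubic ^ ((l^n - 1) div 2)) x)"
    using card_sqrts[OF assms l_ne_2] poly_cubic_Fq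
    by (intro sum.cong) (simp_all add: quad_char_def)
  also have "\<dots> = of_nat (l^n) + (\<Sum>x\<in>Fq n. poly (cubic ^ ((l^n - 1) div 2)) x)"
    using card_Fq[OF assms] by (simp add: sum.distrib)
  also have "(\<Sum>x\<in>Fq n. poly (cubic ^ ((l^n - 1) div 2)) x) = - hasse n"
    unfolding hasse_def
    by (rule sum_poly_Fq) (use assms l_ne_2 q_gt_1[OF assms] in \<open>auto simp: degree_cubic_power\<close>)
  finally show ?thesis using assms by simp
qed

lemma hasse_Suc: "hasse (Suc n) = hasse 1 * hasse n ^ l"
proof -
  let ?h = "cubic ^ ((l - 1) div 2)" and ?G = "cubic ^ ((l^n - 1) div 2)"
  have "odd l" "odd (l^n)" using odd_power_l[OF l_ne_2, of 1] odd_power_l[OF l_ne_2] by auto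
  then obtain s t where l_eq: "l = 2*s+1" and q_eq: "l^n = 2*t+1" by (meson oddE)
  have "l ^ Suc n = (2*s+1) * (2*t+1)" using l_eq q_eq by simp
  then have half: "(l ^ Suc n - 1) div 2 = (l - 1) div 2 + (l^n - 1) div 2 * l"
    using l_eq q_eq by (simp add: algebra_simps)
  have index: "l ^ Suc n - 1 = l - 1 + l * (l^n - 1)"
    using l_eq q_eq by (simp add: algebra_simps)
  have "hasse (Suc n) = coeff (?h * ?G ^ l) (l - 1 + l * (l^n - 1))"
    unfolding hasse_def half power_add power_mult unfolding index ..
  also have "\<dots> = coeff ?h (l - 1) * coeff ?G (l^n - 1) ^ l"
    using l_eq l_gt_1
    by (intro coeff_mult_power_CHAR prime_l CHAR_eq) (simp add: degree_cubic_power)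
  finally show ?thesis by (simp add: hasse_def)
qed

lemma hasse_1_Fq: "hasse 1 \<in> Fq 1"
proof -
  have "hasse 1 = 1 - of_nat (card (carrier (point_group 1)))"
    using of_nat_card_point_group[of 1] by simp
  then show ?thesis by (metis Fq_1 Fq_diff Fq_of_nat)
qed

lemma hasse_power: "n > 0 \<Longrightarrow> hasse n = hasse 1 ^ n"
proof (induction n rule: nat_induct_non_zero)
  case (Suc n)
  have "(hasse 1 ^ n) ^ l = hasse 1 ^ n"
    using Fq_power[OF hasse_1_Fq, of n] by (simp add: Fq_def frob_def)
  then show ?case using Suc hasse_Suc[of n] by simp
qed simp

lemma supersingular_imp_hasse_0:
  assumes "supersingular_curve l a b" shows "hasse 1 = 0"
proof (rule ccontr)
  assume "hasse 1 \<noteq> 0"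
  then have "hasse (l - 1) = 1"
    using Fq_power_minus_1[OF hasse_1_Fq] hasse_power[of "l - 1"] l_gt_1 by simp
  then have "l dvd card (carrier (point_group (l - 1)))"
    using of_nat_card_point_group[of "l - 1"] l_gt_1 by (simp add: of_nat_eq_0_iff_dvd)
  then obtain P where "P \<in> carrier (point_group (l - 1))" "P \<noteq> Inf" "ec_mult a l P = Inf"
    using torsion_point_exists[of "l - 1" l] prime_l l_gt_1 by auto
  then show False using assms by (auto simp: supersingular_curve_def carrier_point_group)
qed

text \<open>Modulo \<open>l\<close> the number of affine points vanishes, so it is \<open>0\<close>, \<open>l\<close> or \<open>2l\<close>; in the extreme
  cases \<open>cubic\<close> would be a nonsquare everywhere, respectively a nonzero square everywhere.\<close>

lemma card_point_group_if_hasse_0: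
  assumes "hasse 1 = 0" shows "card (carrier (point_group 1)) = l + 1"
proof -
  define fibre_card where "fibre_card = (\<lambda>x. card (sqrts 1 (poly cubic x)))"
  have finite: "finite (Fq 1)" and card: "card (Fq 1) = l"
    using finite_Fq[of 1] card_Fq[of 1] by auto
  have fibre_card_le_2: "fibre_card x \<le> 2" for x by (simp add: fibre_card_def card_sqrts_le_2)
  have not_constant: "\<not> (\<forall>x\<in>Fq 1. fibre_card x = v)" for v
  proof
    assume "\<forall>x\<in>Fq 1. fibre_card x = v"
    then have "\<forall>x\<in>Fq 1. quad_char 1 (poly cubic x) = of_nat v - 1"
      using card_sqrts[of 1, OF _ l_ne_2 poly_cubic_Fq] by (auto simp: fibre_card_def)
    then show False using quad_char_cubic_not_constant[OF degree_cubic l_gt_3] by blast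
  qed
  have points: "card (carrier (point_group 1)) = Suc (\<Sum>x\<in>Fq 1. fibre_card x)"
    using card_point_group(2)[of 1] by (simp add: fibre_card_def)
  then have "l dvd (\<Sum>x\<in>Fq 1. fibre_card x)"
    using of_nat_card_point_group[of 1] assms by (simp flip: of_nat_eq_0_iff_dvd)
  then obtain k where multiple: "(\<Sum>x\<in>Fq 1. fibre_card x) = l * k" by blast
  have "(\<Sum>x\<in>Fq 1. fibre_card x) < (\<Sum>x\<in>Fq 1. 2)"
    using finite fibre_card_le_2 not_constant[of 2] le_neq_implies_less
    by (intro sum_strict_mono_ex1) blast+
  then have "k < 2" using multiple card by simp
  moreover have "k \<noteq> 0"
    using multiple sum_eq_0_iff[OF finite, of fibre_card] not_constant[of 0] by auto
  ultimately have "k = 1" by simp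
  then show ?thesis using points multiple by simp
qed

lemma hasse_1_if_b_0:
  assumes "b = 0" "l - 1 = 4 * s" shows "hasse 1 = of_nat (2*s choose s) * a^s"
proof -
  have half: "(l - 1) div 2 = 2 * s" using assms(2) by simp
  have cubic: "cubic = monom 1 3 + monom a 1"
    unfolding cubic_def unfolding assms(1) by (simp add: monom_altdef eval_nat_numeral)
  have "cubic ^ (2 * s) = (\<Sum>k\<le>2*s. of_nat (2*s choose k) * monom 1 3 ^ k * monom a 1 ^ (2*s - k))"
    unfolding cubic by (rule binomial_ring)
  also have "\<dots> = (\<Sum>k\<le>2*s. monom (of_nat (2*s choose k) * a ^ (2*s - k)) (3*k + (2*s - k)))"
    by (rule sum.cong) (simp_all add: monom_power mult_monom of_nat_poly smult_monom)
  finally have "hasse 1 =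
      (\<Sum>k\<le>2*s. coeff (monom (of_nat (2*s choose k) * a ^ (2*s - k)) (3*k + (2*s - k))) (4*s))"
    unfolding hasse_def power_one_right half unfolding assms(2) by (simp only: coeff_sum)
  also have "\<dots> = (\<Sum>k\<le>2*s. if k = s then of_nat (2*s choose s) * a ^ s else 0)"
    by (rule sum.cong) auto
  also have "\<dots> = of_nat (2*s choose s) * a ^ s" by simp
  finally show ?thesis .
qed

lemma hasse_1_nonzero_if_b_0:
  assumes "b = 0" "4 dvd l - 1" shows "hasse 1 \<noteq> 0"
proof -
  obtain s where l_eq: "l - 1 = 4 * s" using assms(2) by blast
  have "\<not> l dvd fact (2*s)" using prime_dvd_fact_iff[OF prime_l] l_eq l_gt_1 by simp
  then have "\<not> l dvd (2*s choose s)"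
    using binomial_fact_lemma[of s "2*s"] by (metis dvd_mult le_add2 mult_2)
  moreover have "a \<noteq> 0" using elliptic assms(1) by (auto simp: elliptic_def)
  ultimately show ?thesis using hasse_1_if_b_0[OF assms(1) l_eq] by (simp add: of_nat_eq_0_iff_dvd)
qed

end

section \<open>Points of order 5\<close>

lemma poly_f0: "poly f0 x = x^4 + 12*x^3 + 14*x^2 - 12*x + 1"
  by (simp add: f0_def algebra_simps eval_nat_numeral)

lemma poly_f1728: "poly f1728 x = x^4 + 18*x^3 + 74*x^2 - 18*x + 1"
  by (simp add: f1728_def algebra_simps eval_nat_numeral)

lemma poly_fj: "poly (fj j) x = (poly f0 x)^3 - j * x^5 * (1 - 11*x - x^2)"
proof -
  have "poly [:1, -11, -1:] x = 1 - 11*x - x^2" by (simp add: algebra_simps power2_eq_square)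
  then show ?thesis
    by (simp only: fj_def f0_def poly_diff poly_power poly_smult poly_mult poly_monom
        mult_1 mult.assoc)
qed

text \<open>The Tate normal form \<open>Y\<^sup>2 + (1 - t) X Y - t Y = X\<^sup>3 - t X\<^sup>2\<close>, in which \<open>(0, 0)\<close> has order 5,
  satisfies \<open>c\<^sub>4 = f\<^sub>0(- t)\<close> and \<open>c\<^sub>6 = - (t\<^sup>2 + 1) f\<^bsub>1728\<^esub>(- t)\<close>. Here \<open>x = - t\<close> and \<open>M\<close> is a
  scaling factor.\<close>

definition tate_form :: "'a::field \<Rightarrow> 'a \<Rightarrow> 'a \<Rightarrow> 'a \<Rightarrow> bool" where
  "tate_form M x a b \<longleftrightarrow>
    48 * a = - (M^4 * poly f0 x) \<and> 864 * b = M^6 * ((x^2 + 1) * poly f1728 x)"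

text \<open>Here \<open>m\<close> is the slope of the tangent at \<open>P\<^sub>1\<close>, \<open>P\<^sub>2 = 2P\<^sub>1\<close>, and \<open>\<mu>\<close> is the slope of the line
  \<open>P\<^sub>1P\<^sub>2\<close>, which is tangent at \<open>P\<^sub>2\<close>. The scaling factor is \<open>M = \<mu> + m\<close>.\<close>

context
  fixes a b x1 y1 x2 y2 m \<mu> :: "'a::field"
  assumes two: "(2::'a) \<noteq> 0" and nondegenerate: "y1 \<noteq> 0" "x1 \<noteq> x2"
    and tangent: "m * (2 * y1) = 3 * x1^2 + a" "x2 = m^2 - 2*x1" "y2 = m * (x1 - x2) - y1"
    and chord: "y2 - y1 = \<mu> * (x2 - x1)" "\<mu>^2 = x1 + 2*x2"
begin

lemma order_five_tate_coordinates:
  defines "M \<equiv> 2 * y1 / (x1 - x2)" and "x \<equiv> (x1 - x2)^3 / (2 * y1)^2"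
  shows "2 * m = (1 + x) * M" "2 * y1 = x * M^3" "12 * x1 = (x^2 + 6*x + 1) * M^2"
proof -
  have "2 * y1 \<noteq> 0" using two nondegenerate by simp
  then have "M \<noteq> 0" and M_times: "M * (x1 - x2) = 2 * y1"
    using nondegenerate by (simp_all add: M_def)
  have "d = d^3 / c^2 * (c / d)^2" if "c \<noteq> 0" "d \<noteq> 0" for c d :: 'a
    using that by (simp add: power2_eq_square power3_eq_cube)
  then have x_times: "x1 - x2 = x * M^2"
    unfolding M_def x_def using \<open>2 * y1 \<noteq> 0\<close> nondegenerate by (metis right_minus_eq)
  show "2 * y1 = x * M^3"
    using M_times by (simp add: x_times power2_eq_square power3_eq_cube mult_ac)
  have "(\<mu> + m) * (x1 - x2) = M * (x1 - x2)"
    using chord(1) tangent(3) M_times by (simp add: algebra_simps)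
  then have sum: "\<mu> + m = M" using nondegenerate by simp
  have "(\<mu> - m) * (\<mu> + m) = \<mu>^2 - m^2" by (simp add: algebra_simps power2_eq_square)
  also have "\<dots> = - (x1 - x2)" unfolding chord(2) tangent(2) by (simp add: algebra_simps)
  also have "\<dots> = - (x * M) * M" unfolding x_times by (simp add: power2_eq_square)
  finally have difference: "\<mu> - m = - (x * M)"
    unfolding sum using \<open>M \<noteq> 0\<close> by (metis mult_right_cancel)
  have "2 * m = (\<mu> + m) - (\<mu> - m)" by simp
  then show slope: "2 * m = (1 + x) * M"
    unfolding sum difference by (simp add: algebra_simps)
  have "12 * x1 = (2 * m)^2 + 4 * (x1 - x2)" using tangent(2) by (simp add: power_mult_distrib)
  also have "\<dots> = (x^2 + 6*x + 1) * M^2" unfolding slope x_times by Groebner_Basis.algebra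
  finally show "12 * x1 = (x^2 + 6*x + 1) * M^2" .
qed

lemma tate_form_if_order_five:
  assumes "y1^2 = x1^3 + a*x1 + b"
  shows "tate_form (2 * y1 / (x1 - x2)) ((x1 - x2)^3 / (2 * y1)^2) a b"
proof -
  define M x where "M = 2 * y1 / (x1 - x2)" and "x = (x1 - x2)^3 / (2 * y1)^2"
  note coordinates = order_five_tate_coordinates[folded M_def x_def]
  have a_eq: "a = m * (2 * y1) - 3 * x1^2" using tangent(1) by simp
  have "48 * a = 24 * ((2 * m) * (2 * y1)) - (12 * x1)^2" unfolding a_eq by Groebner_Basis.algebra
  also have "\<dots> = - (M^4 * poly f0 x)" unfolding coordinates poly_f0 by Groebner_Basis.algebra
  finally have a_tate: "48 * a = - (M^4 * poly f0 x)" .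
  have b_eq: "b = y1^2 - x1^3 - a * x1" using assms by simp
  have "2 * (864 * b) = 432 * (2 * y1)^2 - (12 * x1)^3 - 3 * (48 * a) * (12 * x1)"
    unfolding b_eq by Groebner_Basis.algebra
  also have "\<dots> = 2 * (M^6 * ((x^2 + 1) * poly f1728 x))"
    unfolding a_tate coordinates poly_f0 poly_f1728 by Groebner_Basis.algebra
  finally have "864 * b = M^6 * ((x^2 + 1) * poly f1728 x)"
    unfolding mult_left_cancel[OF two] .
  then show ?thesis using a_tate by (simp add: tate_form_def M_def x_def)
qed

end

lemma fj_root_if_tate_form:
  fixes a b j :: "'a::field"
  assumes "(2::'a) \<noteq> 0" "(3::'a) \<noteq> 0"
    and "M \<noteq> 0" "tate_form M x a b" "elliptic a b" "j_invariant a b = j"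
  shows "poly (fj j) x = 0"
proof -
  define F H where "F = poly f0 x" and "H = (x^2 + 1) * poly f1728 x"
  have a_tate: "48 * a = - (M^4 * F)" and b_tate: "864 * b = M^6 * H"
    using assms(4) by (simp_all add: tate_form_def F_def H_def)
  have j_eq: "1728 * (4 * a^3) = j * (4 * a^3 + 27 * b^2)"
    using assms(5,6) by (simp add: j_invariant_def elliptic_def nonzero_divide_eq_eq)
  have "1728 * (4 * (48 * a)^3) = 48^3 * (1728 * (4 * a^3))" by (simp add: power_mult_distrib)
  also have "\<dots> = j * (4 * (48 * a)^3 + 4 * (864 * b)^2)"
    unfolding j_eq by (simp add: power_mult_distrib algebra_simps)
  finally have "1728 * (4 * (- (M^4 * F))^3) = j * (4 * (- (M^4 * F))^3 + 4 * (M^6 * H)^2)"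
    unfolding a_tate b_tate .
  moreover have "1728 * (4 * (- (M^4 * F))^3) = (4 * M^12) * (- (1728 * F^3))"
    "j * (4 * (- (M^4 * F))^3 + 4 * (M^6 * H)^2) = (4 * M^12) * (j * (H^2 - F^3))"
    by Groebner_Basis.algebra+
  moreover have "4 * M^12 = 2^2 * M^12" by simp
  then have "4 * M^12 \<noteq> 0" using assms(1,3) by (metis mult_eq_0_iff power_not_zero)
  ultimately have "- (1728 * F^3) = j * (H^2 - F^3)" by (metis mult_left_cancel)
  also have "\<dots> = - (1728 * (j * x^5 * (1 - 11*x - x^2)))"
    unfolding F_def H_def poly_f0 poly_f1728 by Groebner_Basis.algebra
  finally have "1728 * F^3 = 1728 * (j * x^5 * (1 - 11*x - x^2))" by simp
  moreover have "(1728::'a) = 2^6 * 3^3" by simp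
  then have "(1728::'a) \<noteq> 0" using assms(1,2) by (metis mult_eq_0_iff power_not_zero)
  ultimately show ?thesis by (simp add: poly_fj F_def)
qed

context elliptic_curve
begin

lemma order_five_triple_eq_neg_double:
  assumes "infinite {P. on P}" "on P" "ec_mult a 5 P = Inf"
  shows "P \<oplus>\<^sub>E (P \<oplus>\<^sub>E P) = ec_neg (P \<oplus>\<^sub>E P)"
proof -
  define D T where "D = P \<oplus>\<^sub>E P" and "T = P \<oplus>\<^sub>E D"
  have on: "on D" "on T" using assms by (simp_all add: D_def T_def)
  have "P \<oplus>\<^sub>E (P \<oplus>\<^sub>E T) = Inf"
    using assms(3) by (simp add: D_def T_def eval_nat_numeral)
  then have "T \<oplus>\<^sub>E D = Inf"
    using add_assoc[OF assms(1,2,2) on(2)] add_commute on by (simp add: D_def)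
  then show ?thesis using add_neg_cancel[OF on(2,1)] by (simp add: D_def T_def)
qed

lemma order_five_coordinates:
  assumes "infinite {P. on P}" "on (Pt x1 y1)" "ec_mult a 5 (Pt x1 y1) = Inf"
  obtains x2 y2 m \<mu> where "Pt x1 y1 \<oplus>\<^sub>E Pt x1 y1 = Pt x2 y2" "y1 \<noteq> 0" "x1 \<noteq> x2"
    "m * (2 * y1) = 3 * x1^2 + a" "x2 = m^2 - 2*x1" "y2 = m * (x1 - x2) - y1"
    "y2 - y1 = \<mu> * (x2 - x1)" "\<mu>^2 = x1 + 2*x2"
proof -
  define P where "P = Pt x1 y1"
  have triple: "P \<oplus>\<^sub>E (P \<oplus>\<^sub>E P) = ec_neg (P \<oplus>\<^sub>E P)"
    using order_five_triple_eq_neg_double assms by (simp add: P_def)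
  then have "P \<oplus>\<^sub>E P \<noteq> Inf" by (auto simp: P_def)
  then have "\<not> (x1 = x1 \<and> y1 = - y1)" unfolding P_def ec_add_Pt by presburger
  moreover define m where "m = ec_slope a x1 y1 x1 y1"
  ultimately have slope: "is_slope a m x1 y1 x1 y1" and "y1 \<noteq> 0"
    using is_slope_ec_slope assms(2) by auto
  obtain x2 y2 where double: "P \<oplus>\<^sub>E P = Pt x2 y2"
    and x2_eq: "x2 = m^2 - 2*x1" and y2_eq: "y2 = m * (x1 - x2) - y1"
    using \<open>P \<oplus>\<^sub>E P \<noteq> Inf\<close> by (auto simp: P_def ec_add_Pt m_def chord_sum_def split: if_splits)
  have "x1 \<noteq> x2"
  proof
    assume "x1 = x2"
    then have "Pt x2 y2 = ec_neg P" using y2_eq by (simp add: P_def)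
    then show False using triple double by simp
  qed
  define \<mu> where "\<mu> = ec_slope a x1 y1 x2 y2"
  have "y2 - y1 = \<mu> * (x2 - x1)" using \<open>x1 \<noteq> x2\<close> by (simp add: \<mu>_def ec_slope_def)
  moreover have "chord_sum \<mu> x1 y1 x2 = Pt x2 (- y2)"
    using triple double \<open>x1 \<noteq> x2\<close> by (simp add: P_def ec_add_Pt \<mu>_def)
  then have "\<mu>^2 = x1 + 2*x2" by (simp add: chord_sum_def algebra_simps)
  moreover have "m * (2 * y1) = 3 * x1^2 + a"
    using slope by (simp add: is_slope_def power2_eq_square algebra_simps)
  ultimately show thesis
    using that double \<open>y1 \<noteq> 0\<close> \<open>x1 \<noteq> x2\<close> x2_eq y2_eq by (simp add: P_def)
qed

end

context elliptic_curve_over_prime_field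
begin

lemma five_torsion_tate_form:
  assumes "on P" "rational 1 P" "P \<noteq> Inf" "ec_mult a 5 P = Inf"
  obtains M x where "x \<in> Fq 1" "M \<noteq> 0" "tate_form M x a b"
proof -
  obtain x1 y1 where P_eq: "P = Pt x1 y1" using assms(3) by (cases P) auto
  obtain x2 y2 m \<mu> where double: "P \<oplus>\<^sub>E P = Pt x2 y2" and nondegenerate: "y1 \<noteq> 0" "x1 \<noteq> x2"
    and lines: "m * (2 * y1) = 3 * x1^2 + a" "x2 = m^2 - 2*x1" "y2 = m * (x1 - x2) - y1"
      "y2 - y1 = \<mu> * (x2 - x1)" "\<mu>^2 = x1 + 2*x2"
    using order_five_coordinates[OF infinite_on] assms P_eq by metis
  have "rational 1 (Pt x2 y2)" using rational_add[OF assms(2,2)] double by simp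
  then have "(x1 - x2)^3 / (2 * y1)^2 \<in> Fq 1" using assms(2) P_eq by (auto intro!: Fq_closed)
  moreover have "2 * y1 / (x1 - x2) \<noteq> 0" using nondegenerate two_nonzero by simp
  moreover have "tate_form (2 * y1 / (x1 - x2)) ((x1 - x2)^3 / (2 * y1)^2) a b"
    using tate_form_if_order_five[OF two_nonzero nondegenerate lines] assms(1) P_eq by simp
  ultimately show thesis using that by blast
qed

end

section \<open>Modular parametrisations of level 5\<close>

text \<open>For the Rogers--Ramanujan continued fraction \<open>R\<close>, \<open>1/R - R - 1\<close> and \<open>1/R\<^sup>5 - R\<^sup>5 - 11\<close> are
  Hauptmoduln of level 25 and 5; their negatives are the values below at \<open>r = - 1/R\<close> and
  \<open>x = r\<^sup>5\<close>, and \<open>quint\<close> is the map from level 25 to level 5.\<close>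

definition hauptmodul5 :: "'a::field \<Rightarrow> 'a" where "hauptmodul5 x = x - 1/x + 11"

definition hauptmodul25 :: "'a::field \<Rightarrow> 'a" where "hauptmodul25 r = r - 1/r + 1"

definition quint :: "'a::comm_ring_1 \<Rightarrow> 'a" where
  "quint p = p^5 - 5*p^4 + 15*p^3 - 25*p^2 + 25*p"

text \<open>The six roots \<open>n\<close> correspond to the six subgroups of order 5 of a curve with invariant \<open>j\<close>.\<close>

definition modular5 :: "'a::comm_ring_1 \<Rightarrow> 'a \<Rightarrow> 'a" where
  "modular5 j n = (n^2 - 10*n + 5)^3 + j*n"

lemma hauptmodul5_eq_iff:
  assumes "x \<noteq> 0" shows "hauptmodul5 x = n \<longleftrightarrow> x^2 - (n - 11)*x - 1 = 0"
  using assms by (auto simp: hauptmodul5_def field_simps power2_eq_square)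

lemma hauptmodul5_minus_11_sq:
  assumes "x \<noteq> 0" shows "(hauptmodul5 x - 11)^2 + 4 = (x + 1/x)^2"
  using assms by (simp add: hauptmodul5_def field_simps power2_eq_square)

lemma
  assumes "x \<noteq> 0"
  defines "n \<equiv> hauptmodul5 x"
  shows poly_f0_hauptmodul5: "poly f0 x = x^2 * (n^2 - 10*n + 5)"
    and poly_f1728_hauptmodul5: "poly f1728 x = x^2 * (n^2 - 4*n - 1)"
    and poly_fj_hauptmodul5: "poly (fj j) x = x^6 * modular5 j n"
proof -
  have xn: "x * n = x^2 + 11*x - 1"
    using assms by (simp add: n_def hauptmodul5_def field_simps power2_eq_square)
  have "x^2 * (n^2 - 10*n + 5) = (x*n)^2 - 10*x*(x*n) + 5*x^2" by Groebner_Basis.algebra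
  also have "\<dots> = poly f0 x" unfolding xn poly_f0 by Groebner_Basis.algebra
  finally show f0: "poly f0 x = x^2 * (n^2 - 10*n + 5)" by simp
  have "x^2 * (n^2 - 4*n - 1) = (x*n)^2 - 4*x*(x*n) - x^2" by Groebner_Basis.algebra
  also have "\<dots> = poly f1728 x" unfolding xn poly_f1728 by Groebner_Basis.algebra
  finally show "poly f1728 x = x^2 * (n^2 - 4*n - 1)" by simp
  have linear: "1 - 11*x - x^2 = - (x * n)" unfolding xn by simp
  show "poly (fj j) x = x^6 * modular5 j n"
    unfolding poly_fj f0 linear modular5_def by Groebner_Basis.algebra
qed

lemma quint_hauptmodul25:
  fixes r :: "'a::field"
  assumes "r \<noteq> 0" shows "quint (hauptmodul25 r) = hauptmodul5 (r^5)"
proof -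
  define i where "i = 1/r"
  have r_times_i: "r * i = 1" using assms by (simp add: i_def)
  have "quint (r - i + 1) = (r - i)^5 + 5 * (r - i)^3 + 5 * (r - i) + 11"
    unfolding quint_def by Groebner_Basis.algebra
  also have "(r - i)^5 = r^5 - i^5 - 5 * (r * i) * (r^3 - i^3) + 10 * (r * i)^2 * (r - i)"
    by Groebner_Basis.algebra
  also have "(r - i)^3 = r^3 - i^3 - 3 * (r * i) * (r - i)"
    by Groebner_Basis.algebra
  finally have "quint (r - i + 1) = r^5 - i^5 + 11"
    unfolding r_times_i by (simp add: algebra_simps)
  then show ?thesis by (simp add: hauptmodul25_def hauptmodul5_def i_def power_one_over)
qed

subsection \<open>The values at which the parametrisation degenerates\<close>

lemma factor_of_125_nonzero:
  fixes n B :: "'a::field"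
  assumes "(5::'a) \<noteq> 0" "n * B = 125" shows "B \<noteq> 0"
proof
  assume "B = 0"
  then have "(5::'a)^3 = 0" using assms(2) by simp
  then show False using assms(1) power_not_zero by blast
qed

lemma modular5_nonzero_root:
  fixes n :: "'a::field"
  assumes "(5::'a) \<noteq> 0" "modular5 j n = 0" shows "n \<noteq> 0"
proof
  assume "n = 0"
  then have "(5::'a)^3 = 0" using assms(2) by (simp add: modular5_def)
  then show False using assms(1) power_not_zero by blast
qed

lemma modular5_j_0:
  fixes n :: "'a::field"
  assumes "(5::'a) \<noteq> 0" "modular5 j n = 0" "n^2 - 10*n + 5 = 0" shows "j = 0"
  using assms modular5_nonzero_root[OF assms(1,2)] by (simp add: modular5_def)

lemma modular5_j_1728:
  fixes n :: "'a::field"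
  assumes "(5::'a) \<noteq> 0" "modular5 j n = 0" "n^2 - 4*n - 1 = 0 \<or> (n - 11)^2 + 4 = 0"
  shows "j = 1728"
proof -
  have "(j - 1728) * n = modular5 j n - ((n - 11)^2 + 4) * (n^2 - 4*n - 1)^2"
    unfolding modular5_def by Groebner_Basis.algebra
  then show ?thesis using assms modular5_nonzero_root[OF assms(1,2)] by auto
qed

text \<open>These are the images of the multiple roots of \<open>modular5 0\<close> and \<open>modular5 1728\<close> under the Fricke
  involution \<open>n \<mapsto> 125 / n\<close>.\<close>

definition special5 :: "'a::comm_ring_1 \<Rightarrow> bool" where
  "special5 B \<longleftrightarrow> B^2 - 250*B + 3125 = 0 \<or> B^2 + 500*B - 15625 = 0"

lemma special5_imp_special_j:
  fixes n B j :: "'a::field"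
  assumes "(5::'a) \<noteq> 0" "modular5 j n = 0" "n * B = 125" "special5 B" shows "j = 0 \<or> j = 1728"
proof -
  have "B \<noteq> 0" using factor_of_125_nonzero assms(1,3) by blast
  have "B^2 * (n^2 - 10*n + 5) = (n*B)^2 - 10*(n*B)*B + 5*B^2" by Groebner_Basis.algebra
  also have "\<dots> = 5 * (B^2 - 250*B + 3125)" unfolding assms(3) by Groebner_Basis.algebra
  finally have "B^2 - 250*B + 3125 = 0 \<Longrightarrow> n^2 - 10*n + 5 = 0" using \<open>B \<noteq> 0\<close> by simp
  moreover have "B^2 * (n^2 - 4*n - 1) = (n*B)^2 - 4*(n*B)*B - B^2" by Groebner_Basis.algebra
  then have "B^2 * (n^2 - 4*n - 1) = - (B^2 + 500*B - 15625)"
    unfolding assms(3) by simp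
  then have "B^2 + 500*B - 15625 = 0 \<Longrightarrow> n^2 - 4*n - 1 = 0" using \<open>B \<noteq> 0\<close> by simp
  ultimately show ?thesis
    using assms modular5_j_0 modular5_j_1728 unfolding special5_def by blast
qed

text \<open>For \<open>s = p + p'\<close> and \<open>m = p p'\<close> these are \<open>(quint p - quint p') / (p - p')\<close> and
  \<open>quint p + quint p'\<close>.\<close>

definition quint_quotient :: "'a::comm_ring_1 \<Rightarrow> 'a \<Rightarrow> 'a" where
  "quint_quotient s m =
    s^4 - 3*s^2*m + m^2 - 5*(s^3 - 2*s*m) + 15*(s^2 - m) - 25*s + 25"

definition quint_sum :: "'a::comm_ring_1 \<Rightarrow> 'a \<Rightarrow> 'a" where
  "quint_sum s m = s^5 - 5*s^3*m + 5*s*m^2 - 5*s^4 + 20*s^2*m - 10*m^2 + 15*s^3 - 45*s*m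
    - 25*s^2 + 50*m + 25*s"

lemma quint_diff:
  fixes p p' :: "'a::idom"
  shows "quint p - quint p' = (p - p') * quint_quotient (p + p') (p * p')"
  unfolding quint_def quint_quotient_def by Groebner_Basis.algebra

lemma quint_add:
  fixes p p' :: "'a::idom"
  shows "quint p + quint p' = quint_sum (p + p') (p * p')"
  unfolding quint_def quint_sum_def by Groebner_Basis.algebra

context
  fixes B s m :: "'a::field"
  assumes two: "(2::'a) \<noteq> 0"
    and quotient: "quint_quotient s m = 0" and sum: "2 * B = quint_sum s m"
begin

lemma special5_if_sum_0:
  assumes "s = 0" shows "special5 B"
proof -
  have relation: "m^2 - 15*m + 25 = 0" using quotient assms by (simp add: quint_quotient_def)
  have "2*B = 2 * (- 50*m + 125) - 10 * (m^2 - 15*m + 25)"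
    unfolding sum quint_sum_def assms by (simp add: algebra_simps)
  then have "2*B = 2 * (- 50*m + 125)" unfolding relation by simp
  then have B_eq: "B = - 50*m + 125" unfolding mult_left_cancel[OF two] .
  have "B^2 + 500*B - 15625 = 2500 * (m^2 - 15*m + 25)"
    unfolding B_eq by Groebner_Basis.algebra
  then show ?thesis unfolding relation by (simp add: special5_def)
qed

lemma special5_if_product_eq_sum_sq:
  assumes "m = s^2" shows "special5 B"
proof -
  have "s^4 - 5*s^3 + 25*s - 25 = - quint_quotient s m"
    unfolding assms quint_quotient_def by Groebner_Basis.algebra
  then have relation: "s^4 - 5*s^3 + 25*s - 25 = 0" unfolding quotient by simp
  have "2*B = 2 * (10*s^3 - 100*s + 125) + (s + 10) * (s^4 - 5*s^3 + 25*s - 25)"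
    unfolding sum quint_sum_def assms by Groebner_Basis.algebra
  then have "2*B = 2 * (10*s^3 - 100*s + 125)" unfolding relation by simp
  then have B_eq: "B = 10*s^3 - 100*s + 125" unfolding mult_left_cancel[OF two] .
  have "B^2 - 250*B + 3125 = 100 * (s^2 + 5*s + 5) * (s^4 - 5*s^3 + 25*s - 25)"
    unfolding B_eq by Groebner_Basis.algebra
  then show ?thesis unfolding relation by (simp add: special5_def)
qed

lemma special5_if_sum_sq_eq_3_product:
  assumes three: "(3::'a) \<noteq> 0" and "s^2 = 3*m" shows "special5 B"
proof -
  define c where "c = s / 3"
  have s_eq: "s = 3*c" using three by (simp add: c_def)
  have "3 * m = 3 * (3*c^2)" using assms(2) unfolding s_eq by (simp add: power2_eq_square)
  then have m_eq: "m = 3*c^2" unfolding mult_left_cancel[OF three] .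
  have "9*c^4 - 45*c^3 + 90*c^2 - 75*c + 25 = quint_quotient s m"
    unfolding s_eq m_eq quint_quotient_def by Groebner_Basis.algebra
  then have relation: "9*c^4 - 45*c^3 + 90*c^2 - 75*c + 25 = 0" unfolding quotient .
  have "2*B = 2 * (- 90*c^3 + 300*c^2 - 300*c + 125)
      + (- 3*c - 10) * (9*c^4 - 45*c^3 + 90*c^2 - 75*c + 25)"
    unfolding sum quint_sum_def s_eq m_eq by Groebner_Basis.algebra
  then have "2*B = 2 * (- 90*c^3 + 300*c^2 - 300*c + 125)" unfolding relation by simp
  then have B_eq: "B = - 90*c^3 + 300*c^2 - 300*c + 125" unfolding mult_left_cancel[OF two] .
  have "B^2 - 250*B + 3125 = (900*c^2 - 1500*c - 500) * (9*c^4 - 45*c^3 + 90*c^2 - 75*c + 25)"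
    unfolding B_eq by Groebner_Basis.algebra
  then show ?thesis unfolding relation by (simp add: special5_def)
qed

end

lemma special5_if_power6_eq:
  fixes p p' :: "'a::field"
  assumes "(2::'a) \<noteq> 0" "(3::'a) \<noteq> 0"
    and "quint p = B" "quint p' = B" "p \<noteq> p'" "p^6 = p'^6"
  shows "special5 B"
proof -
  define s m where "s = p + p'" and "m = p * p'"
  have quotient: "quint_quotient s m = 0"
    using quint_diff[of p p'] assms by (simp add: s_def m_def)
  have sum: "2 * B = quint_sum s m"
    using quint_add[of p p'] assms by (simp add: s_def m_def)
  have "(p - p') * (s * ((s^2 - m) * (s^2 - 3*m))) = p^6 - p'^6"
    unfolding s_def m_def by Groebner_Basis.algebra
  then have "s = 0 \<or> m = s^2 \<or> s^2 = 3*m" using assms(5,6) by auto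
  then show ?thesis
    using special5_if_sum_0[OF assms(1) quotient sum]
      special5_if_product_eq_sum_sq[OF assms(1) quotient sum]
      special5_if_sum_sq_eq_3_product[OF assms(1) quotient sum assms(2)] by blast
qed

lemma special5_if_power6_eq_125:
  fixes p :: "'a::field"
  assumes "quint p = B" "p^6 = 125" shows "special5 B"
proof -
  have "(p^2 - 5) * (p^4 + 5*p^2 + 25) = p^6 - 125" by Groebner_Basis.algebra
  then consider (sqrt5) "p^2 - 5 = 0" | (quartic) "p^4 + 5*p^2 + 25 = 0" using assms(2) by auto
  then show ?thesis
  proof cases
    case sqrt5
    have "B = 125*p - 250 + (p^2 - 5) * (p^3 - 5*p^2 + 20*p - 50)"
      unfolding assms(1)[symmetric] quint_def by Groebner_Basis.algebra
    then have B_eq: "B = 125*p - 250" unfolding sqrt5 by simp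
    have "B^2 + 500*B - 15625 = 15625 * (p^2 - 5)" unfolding B_eq by Groebner_Basis.algebra
    then show ?thesis unfolding sqrt5 by (simp add: special5_def)
  next
    case quartic
    have "B = 10*p^3 + 125 + (p^4 + 5*p^2 + 25) * (p - 5)"
      unfolding assms(1)[symmetric] quint_def by Groebner_Basis.algebra
    then have B_eq: "B = 10*p^3 + 125" unfolding quartic by simp
    have "B^2 - 250*B + 3125 = 100 * (p^6 - 125)" unfolding B_eq by Groebner_Basis.algebra
    then show ?thesis using assms(2) by (simp add: special5_def)
  qed
qed

subsection \<open>The roots conjugate to a given one\<close>

text \<open>If \<open>125 / hauptmodul5 y\<close> is one root of \<open>modular5 j\<close>, the other five arise from the fifth roots
  \<open>r\<close> of \<open>y\<close>.\<close>

definition conjugate_root :: "'a::field \<Rightarrow> 'a" where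
  "conjugate_root r = hauptmodul25 r ^ 6 / hauptmodul5 (r^5)"

lemma modular5_quint_transfer:
  fixes p n n' j :: "'a::field"
  assumes five: "(5::'a) \<noteq> 0" and root: "n * quint p = 125" "modular5 j n = 0"
    and image: "n' * quint p = p^6"
  shows "modular5 j n' = 0"
proof -
  define q where "q = p^4 - 5*p^3 + 15*p^2 - 25*p + 25"
  have quint: "quint p = p * q" unfolding quint_def q_def by Groebner_Basis.algebra
  have nonzero: "p \<noteq> 0" "q \<noteq> 0" using factor_of_125_nonzero[OF five root(1)] quint by auto
  have n_times_pq: "n * (p * q) = 125" using root(1) quint by simp
  have "p * (n' * q) = p * p^5" using image quint by (simp add: mult_ac flip: power_Suc)
  then have n'q: "n' * q = p^5" using nonzero by simp
  have "(p*q)^2 * (n^2 - 10*n + 5) = (n*(p*q))^2 - 10*(n*(p*q))*(p*q) + 5*(p*q)^2"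
    by Groebner_Basis.algebra
  also have "\<dots> = 5 * (p^10 - 10*p^5*q + 5*q^2)"
    unfolding n_times_pq unfolding q_def by Groebner_Basis.algebra
  also have "p^10 - 10*p^5*q + 5*q^2 = (n'*q)^2 - 10*(n'*q)*q + 5*q^2"
    unfolding n'q by Groebner_Basis.algebra
  also have "\<dots> = q^2 * (n'^2 - 10*n' + 5)" by Groebner_Basis.algebra
  finally have "q^2 * (p^2 * (n^2 - 10*n + 5)) = q^2 * (5 * (n'^2 - 10*n' + 5))"
    by (simp add: power_mult_distrib mult_ac)
  then have quadratic: "p^2 * (n^2 - 10*n + 5) = 5 * (n'^2 - 10*n' + 5)" using nonzero by simp
  have "quint p * (p^6 * n) = p^6 * (n * quint p)" by (simp add: mult_ac)
  also have "\<dots> = quint p * (125 * n')" unfolding root(1) image[symmetric] by (simp add: mult_ac)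
  finally have linear: "p^6 * n = 125 * n'" using nonzero quint by simp
  have "5^3 * modular5 j n' = (5 * (n'^2 - 10*n' + 5))^3 + j * (125 * n')"
    unfolding modular5_def by Groebner_Basis.algebra
  also have "\<dots> = p^6 * modular5 j n"
    unfolding quadratic[symmetric] linear[symmetric] modular5_def by Groebner_Basis.algebra
  finally show ?thesis using root(2) five by (metis mult_eq_0_iff power_not_zero)
qed

lemma conjugate_root_discriminant:
  fixes r :: "'a::field"
  assumes r_nonzero: "r \<noteq> 0" and "hauptmodul5 (r^5) \<noteq> 0"
  defines "p \<equiv> hauptmodul25 r"
  shows "(conjugate_root r - 11)^2 + 4 =
    (p * (r + 1/r) * (p^4 - 10*p^3 + 45*p^2 - 100*p + 125) / hauptmodul5 (r^5))^2"
proof -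
  define i B n where "i = 1/r" and "B = hauptmodul5 (r^5)" and "n = conjugate_root r"
  have "B \<noteq> 0" using assms(2) by (simp add: B_def)
  have r_times_i: "r * i = 1" using r_nonzero by (simp add: i_def)
  have n_times_B: "n * B = p^6" using \<open>B \<noteq> 0\<close> by (simp add: n_def conjugate_root_def B_def p_def)
  have B_eq: "B = quint p" by (simp add: B_def p_def quint_hauptmodul25[OF r_nonzero])
  have "(r + i)^2 = (r - i)^2 + 4 * (r * i)" by Groebner_Basis.algebra
  also have "\<dots> = (p - 1)^2 + 4" unfolding r_times_i by (simp add: p_def hauptmodul25_def i_def)
  finally have sum: "(r + i)^2 = (p - 1)^2 + 4" .
  have "B^2 * ((n - 11)^2 + 4) = (n*B)^2 - 22*(n*B)*B + 125*B^2" by Groebner_Basis.algebra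
  also have "\<dots> = p^2 * ((p - 1)^2 + 4) * (p^4 - 10*p^3 + 45*p^2 - 100*p + 125)^2"
    unfolding n_times_B unfolding B_eq quint_def by Groebner_Basis.algebra
  also have "\<dots> = (p * (r + i) * (p^4 - 10*p^3 + 45*p^2 - 100*p + 125))^2"
    unfolding sum[symmetric] by (simp add: power_mult_distrib)
  finally show ?thesis
    using \<open>B \<noteq> 0\<close>
    by (simp add: power_divide nonzero_eq_divide_eq mult.commute i_def n_def B_def)
qed

lemma hauptmodul25_inj:
  fixes r r' :: "'a::field"
  assumes "r \<noteq> 0" "(hauptmodul5 (r^5) - 11)^2 + 4 \<noteq> 0"
    and "r'^5 = r^5" "hauptmodul25 r' = hauptmodul25 r"
  shows "r' = r"
proof (rule ccontr)
  assume "r' \<noteq> r"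
  have "r' \<noteq> 0" using assms(1,3) by auto
  then have "(r' - r) * (r' * r + 1) = 0"
    using assms(1,4) by (simp add: hauptmodul25_def field_simps)
  then have "r' * r = - 1" using \<open>r' \<noteq> r\<close> by (simp add: eq_neg_iff_add_eq_0)
  then have "(r' * r)^5 = - 1" by simp
  then have inverse: "r^5 * r^5 = - 1" using assms(3) by (simp add: power_mult_distrib)
  then have "1 / r^5 = - (r^5)" using assms(1) by (simp add: field_simps)
  then have "(hauptmodul5 (r^5) - 11)^2 + 4 = 4 * (r^5 * r^5 + 1)"
    by (simp add: hauptmodul5_def power2_eq_square algebra_simps)
  then show False using inverse assms(2) by simp
qed

context
  fixes r n j :: "'a::field"
  assumes five: "(5::'a) \<noteq> 0"
    and root: "n * hauptmodul5 (r^5) = 125" "modular5 j n = 0" and r_nonzero: "r \<noteq> 0"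
begin

lemma modular5_conjugate_root: "modular5 j (conjugate_root r) = 0"
  by (rule modular5_quint_transfer[OF five, of n "hauptmodul25 r"])
    (use root factor_of_125_nonzero[OF five root(1)]
      in \<open>simp_all add: quint_hauptmodul25[OF r_nonzero] conjugate_root_def\<close>)

lemma conjugate_root_neq:
  assumes "j \<noteq> 0" "j \<noteq> 1728" shows "conjugate_root r \<noteq> n"
proof
  assume "conjugate_root r = n"
  then have "hauptmodul25 r ^ 6 = 125"
    using root(1) factor_of_125_nonzero[OF five root(1)] by (auto simp: conjugate_root_def)
  then have "special5 (hauptmodul5 (r^5))"
    using special5_if_power6_eq_125[OF quint_hauptmodul25[OF r_nonzero]] by blast
  then show False using special5_imp_special_j[OF five root(2,1)] assms by blast
qed

lemma hauptmodul5_power5_discriminant: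
  assumes "j \<noteq> 1728" shows "(hauptmodul5 (r^5) - 11)^2 + 4 \<noteq> 0"
proof
  define B where "B = hauptmodul5 (r^5)"
  assume "(hauptmodul5 (r^5) - 11)^2 + 4 = 0"
  have "B^2 * ((n - 11)^2 + 4) = (n*B)^2 - 22*(n*B)*B + 125*B^2" by Groebner_Basis.algebra
  also have "\<dots> = 125 * ((B - 11)^2 + 4)"
    using root(1) unfolding B_def[symmetric] by (simp add: power2_eq_square algebra_simps)
  finally have "(n - 11)^2 + 4 = 0"
    using \<open>(hauptmodul5 (r^5) - 11)^2 + 4 = 0\<close> factor_of_125_nonzero[OF five root(1)]
    by (simp add: B_def)
  then show False using modular5_j_1728[OF five root(2)] assms by blast
qed

lemma conjugate_root_inj:
  assumes "(2::'a) \<noteq> 0" "(3::'a) \<noteq> 0" and "j \<noteq> 0" "j \<noteq> 1728"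
    and "r'^5 = r^5" "conjugate_root r' = conjugate_root r"
  shows "r' = r"
proof (rule hauptmodul25_inj[OF r_nonzero hauptmodul5_power5_discriminant[OF assms(4)] assms(5)],
    rule ccontr)
  assume "hauptmodul25 r' \<noteq> hauptmodul25 r"
  moreover have "r' \<noteq> 0" using assms(5) r_nonzero by auto
  then have "quint (hauptmodul25 r') = hauptmodul5 (r^5)"
    using quint_hauptmodul25 assms(5) by metis
  moreover have "hauptmodul25 r' ^ 6 = hauptmodul25 r ^ 6"
    using assms(5,6) factor_of_125_nonzero[OF five root(1)] by (simp add: conjugate_root_def)
  ultimately have "special5 (hauptmodul5 (r^5))"
    using special5_if_power6_eq[OF assms(1,2) _ quint_hauptmodul25[OF r_nonzero]] by blast
  then show False using special5_imp_special_j[OF five root(2,1)] assms by blast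
qed

end

section \<open>Rational roots\<close>

locale alg_closed_field_char_4_mod_5 = alg_closed_prime_char_field K l
  for K :: "'k::field itself" and l :: nat +
  assumes l_mod_5: "l mod 5 = 4"
begin

lemma l_gt_3: "l > 3"
  using l_gt_1 l_mod_5 by presburger

lemma two_neq_0: "(2::'k) \<noteq> 0" and three_neq_0: "(3::'k) \<noteq> 0" and five_neq_0: "(5::'k) \<noteq> 0"
  using of_nat_prime_nonzero[of 2] of_nat_prime_nonzero[of 3] of_nat_prime_nonzero[of 5] l_mod_5
  by fastforce+

lemma two_three_smooth_nonzero: "(2::'k) ^ i * 3 ^ k \<noteq> 0"
  using two_neq_0 three_neq_0 by simp

lemma sqrt5_exists:
  obtains s where "s \<in> Fq 1" "s \<noteq> 0" "s^2 = 5"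
proof -
  obtain z :: 'k where "poly [:1, 1, 1, 1, 1:] z = 0" using closed[of "[:1, 1, 1, 1, 1:]"] by auto
  then have cyclotomic: "z^4 + z^3 + z^2 + z + 1 = 0" by (simp add: eval_nat_numeral algebra_simps)
  have "z^5 = (z - 1) * (z^4 + z^3 + z^2 + z + 1) + 1" by Groebner_Basis.algebra
  then have z_power_5: "z^5 = 1" unfolding cyclotomic by simp
  have "z ^ l = (z^5) ^ (l div 5) * z^4"
    using l_mod_5 by (metis mult_div_mod_eq power_add power_mult)
  then have frob_z: "frob 1 z = z^4" by (simp add: frob_def z_power_5)
  have "frob 1 (z^4) = (z^5)^3 * z"
    unfolding frob.hom_power frob_z by (simp flip: power_mult power_Suc2)
  then have "frob 1 (z + z^4) = z + z^4" unfolding frob.hom_add frob_z z_power_5 by simp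
  then have "z + z^4 \<in> Fq 1" unfolding Fq_def by blast
  then have "2 * (z + z^4) + 1 \<in> Fq 1" using Fq_add[OF Fq_mult[OF Fq_numeral] Fq_1] by blast
  moreover have "(2 * (z + z^4) + 1)^2 = 4 * (z^5 * (z^3 + 2) + z^2 + z + z^4) + 1"
    by Groebner_Basis.algebra
  then have "(2 * (z + z^4) + 1)^2 = 4 * (z^4 + z^3 + z^2 + z + 1) + 5"
    unfolding z_power_5 by (simp add: algebra_simps)
  then have "(2 * (z + z^4) + 1)^2 = 5" unfolding cyclotomic by simp
  ultimately show thesis using that five_neq_0 by fastforce
qed

lemma bij_betw_fifth_power: "bij_betw (\<lambda>x. x^5) (Fq 1) (Fq 1)"
proof (rule bij_betw_power_Fq)
  have "\<not> 5 dvd l - 1" using l_mod_5 by presburger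
  then show "coprime 5 (l^1 - 1)" by (intro prime_imp_coprime) simp_all
qed simp

subsection \<open>Rational fibres of the level 5 parametrisation\<close>

definition fibre5 :: "'k \<Rightarrow> 'k set" where
  "fibre5 n = {x \<in> Fq 1. x \<noteq> 0 \<and> hauptmodul5 x = n}"

definition split5 :: "'k \<Rightarrow> bool" where
  "split5 n \<longleftrightarrow> n \<in> Fq 1 \<and> (\<exists>w\<in>Fq 1. w \<noteq> 0 \<and> w^2 = (n - 11)^2 + 4)"

lemma hauptmodul5_Fq: "x \<in> Fq m \<Longrightarrow> hauptmodul5 x \<in> Fq m"
  by (auto simp: hauptmodul5_def intro!: Fq_closed)

lemma hauptmodul25_Fq: "r \<in> Fq m \<Longrightarrow> hauptmodul25 r \<in> Fq m"
  by (auto simp: hauptmodul25_def intro!: Fq_closed)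

lemma split5_hauptmodul5:
  assumes "x \<in> Fq 1" "x \<noteq> 0" "(hauptmodul5 x - 11)^2 + 4 \<noteq> 0" shows "split5 (hauptmodul5 x)"
proof -
  have "x + 1/x \<noteq> 0" "x + 1/x \<in> Fq 1"
    using assms hauptmodul5_minus_11_sq[OF assms(2)] by (auto intro!: Fq_closed)
  then show ?thesis
    using hauptmodul5_minus_11_sq[OF assms(2)] hauptmodul5_Fq[OF assms(1)]
    by (auto simp: split5_def)
qed

lemma card_fibre5:
  assumes "split5 n" shows "card (fibre5 n) = 2"
proof -
  obtain w where sqrt_disc: "w \<in> Fq 1" "w \<noteq> 0" "w^2 = (n - 11)^2 + 4" and n_Fq: "n \<in> Fq 1"
    using assms by (auto simp: split5_def)
  define u where "u = n - 11"
  have "(4::'k) \<noteq> 0" using two_three_smooth_nonzero[of 2 0] by simp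
  have "4 * (x^2 - u*x - 1) = (2*x - (u + w)) * (2*x - (u - w))" for x
  proof -
    have "4 * (x^2 - u*x - 1) = (2*x - u)^2 - (u^2 + 4)" by Groebner_Basis.algebra
    also have "\<dots> = (2*x - u)^2 - w^2" using sqrt_disc(3) by (simp add: u_def)
    also have "\<dots> = (2*x - (u + w)) * (2*x - (u - w))" by Groebner_Basis.algebra
    finally show ?thesis .
  qed
  then have "x^2 - u*x - 1 = 0 \<longleftrightarrow> 2*x = u + w \<or> 2*x = u - w" for x
    using \<open>(4::'k) \<noteq> 0\<close> by (metis mult_eq_0_iff right_minus_eq)
  moreover have "2*x = c \<longleftrightarrow> x = c/2" for x c :: 'k using two_neq_0 by (auto simp: field_simps)
  ultimately have roots: "x^2 - u*x - 1 = 0 \<longleftrightarrow> x = (u + w)/2 \<or> x = (u - w)/2" for x by simp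
  have "x^2 - u*x - 1 = 0 \<longleftrightarrow> x \<noteq> 0 \<and> hauptmodul5 x = n" for x
    using hauptmodul5_eq_iff[of x n] by (cases "x = 0") (simp_all add: u_def)
  then have "fibre5 n = {x \<in> Fq 1. x^2 - u*x - 1 = 0}" by (simp add: fibre5_def)
  also have "\<dots> = {(u + w)/2, (u - w)/2}"
    using sqrt_disc n_Fq roots by (auto simp: u_def intro!: Fq_closed)
  also have "(u + w)/2 \<noteq> (u - w)/2"
    using two_neq_0 \<open>(4::'k) \<noteq> 0\<close> sqrt_disc(2) by (simp add: eq_neg_iff_add_eq_0)
  then have "card {(u + w)/2, (u - w)/2} = 2" by simp
  finally show ?thesis .
qed

lemma card_two_fibres5:
  assumes "split5 n" "split5 n'" "n \<noteq> n'" shows "card (fibre5 n \<union> fibre5 n') = 4"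
proof -
  have "fibre5 n \<inter> fibre5 n' = {}" using assms(3) by (auto simp: fibre5_def)
  moreover have "finite (fibre5 n)" "finite (fibre5 n')"
    using card_fibre5 assms by (auto intro: card_ge_0_finite)
  ultimately show ?thesis using card_fibre5 assms by (simp add: card_Un_disjoint)
qed

lemma split5_conjugate:
  assumes "split5 n" "n' \<in> Fq 1" and c_Fq: "c \<in> Fq 1" "c \<noteq> 0"
    and norm: "((n - 11)^2 + 4) * ((n' - 11)^2 + 4) = c^2"
  shows "split5 n'"
proof -
  obtain w where sqrt_disc: "w \<in> Fq 1" "w \<noteq> 0" "w^2 = (n - 11)^2 + 4"
    using assms(1) by (auto simp: split5_def)
  have "w^2 * (c/w)^2 = w^2 * ((n' - 11)^2 + 4)"
    using sqrt_disc(2) norm by (simp add: power_divide sqrt_disc(3)[symmetric])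
  then have "(c/w)^2 = (n' - 11)^2 + 4" using sqrt_disc(2) by simp
  then show ?thesis using assms(2) sqrt_disc c_Fq
    by (auto simp: split5_def intro!: bexI[of _ "c/w"])
qed

lemma card_conjugate_fibres5:
  assumes rational: "n \<in> Fq 1" "n' \<in> Fq 1" "n \<noteq> n'" and c_Fq: "c \<in> Fq 1" "c \<noteq> 0"
    and norm: "((n - 11)^2 + 4) * ((n' - 11)^2 + 4) = c^2"
    and "fibre5 n \<union> fibre5 n' \<noteq> {}"
  shows "card (fibre5 n \<union> fibre5 n') = 4"
proof -
  obtain x where "x \<in> Fq 1" "x \<noteq> 0" "hauptmodul5 x = n \<or> hauptmodul5 x = n'"
    using assms(7) by (auto simp: fibre5_def)
  moreover have "(n - 11)^2 + 4 \<noteq> 0" "(n' - 11)^2 + 4 \<noteq> 0" using norm c_Fq(2) by auto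
  ultimately have "split5 n \<or> split5 n'" using split5_hauptmodul5 by metis
  then have "split5 n" "split5 n'"
    using split5_conjugate rational c_Fq norm by (metis mult.commute)+
  then show ?thesis using card_two_fibres5 rational(3) by blast
qed

lemma card_roots_conjugate_quadratics:
  assumes coeffs: "c \<in> Fq 1" "d \<in> Fq 1" "d \<noteq> 0" "e \<in> Fq 1" "e \<noteq> 0"
    and norm: "((c - 11)^2 + 5*d^2 + 4)^2 - 20*(c - 11)^2*d^2 = 5*e^2"
    and f_0: "poly f 0 \<noteq> 0"
    and f_factor: "\<And>x. x \<noteq> 0 \<Longrightarrow> poly f x = x^2 * ((hauptmodul5 x - c)^2 - 5*d^2)"
    and root: "x \<in> Fq 1" "poly f x = 0"
  shows "card {x \<in> Fq 1. poly f x = 0} = 4"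
proof -
  obtain s where sqrt5: "s \<in> Fq 1" "s \<noteq> 0" "s^2 = 5" by (rule sqrt5_exists)
  define n n' where "n = c + d*s" and "n' = c - d*s"
  have "(k - c)^2 - 5*d^2 = (k - n) * (k - n')" for k
    unfolding sqrt5(3)[symmetric] n_def n'_def by Groebner_Basis.algebra
  then have "poly f x = 0 \<longleftrightarrow> x \<noteq> 0 \<and> (hauptmodul5 x = n \<or> hauptmodul5 x = n')" for x
    using f_factor[of x] f_0 by (cases "x = 0") simp_all
  then have roots: "{x \<in> Fq 1. poly f x = 0} = fibre5 n \<union> fibre5 n'" by (auto simp: fibre5_def)
  show ?thesis
    unfolding roots
  proof (rule card_conjugate_fibres5)
    show "((n - 11)^2 + 4) * ((n' - 11)^2 + 4) = (e * s)^2"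
    proof -
      have "((n - 11)^2 + 4) * ((n' - 11)^2 + 4) =
          ((c - 11)^2 + s^2 * d^2 + 4)^2 - 4 * s^2 * (c - 11)^2 * d^2"
        unfolding n_def n'_def by Groebner_Basis.algebra
      also have "\<dots> = 5 * e^2" unfolding sqrt5(3) using norm by simp
      finally show ?thesis by (simp add: power_mult_distrib sqrt5(3))
    qed
    have "n - n' = 2 * (d * s)" by (simp add: n_def n'_def)
    then show "n \<noteq> n'" using sqrt5(2) coeffs(3) two_neq_0 by auto
    show "n \<in> Fq 1" "n' \<in> Fq 1" "e * s \<in> Fq 1"
      unfolding n_def n'_def using sqrt5(1) coeffs by (auto intro!: Fq_closed)
    show "e * s \<noteq> 0" using sqrt5(2) coeffs(5) by simp
    show "fibre5 n \<union> fibre5 n' \<noteq> {}" using root roots by blast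
  qed
qed

lemma card_roots_f0:
  assumes "x \<in> Fq 1" "poly f0 x = 0" shows "card {x \<in> Fq 1. poly f0 x = 0} = 4"
proof (rule card_roots_conjugate_quadratics[OF _ _ _ _ _ _ _ _ assms])
  show "poly f0 x = x^2 * ((hauptmodul5 x - 5)^2 - 5*2^2)" if "x \<noteq> 0" for x :: 'k
    unfolding poly_f0_hauptmodul5[OF that] by Groebner_Basis.algebra
  show "(12::'k) \<noteq> 0" using two_three_smooth_nonzero[of 2 1] by simp
qed (simp_all add: two_neq_0 poly_f0)

lemma card_roots_f1728:
  assumes "x \<in> Fq 1" "poly f1728 x = 0" shows "card {x \<in> Fq 1. poly f1728 x = 0} = 4"
proof (rule card_roots_conjugate_quadratics[OF _ _ _ _ _ _ _ _ assms])
  show "poly f1728 x = x^2 * ((hauptmodul5 x - 2)^2 - 5*1^2)" if "x \<noteq> 0" for x :: 'k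
    unfolding poly_f1728_hauptmodul5[OF that] power_one by Groebner_Basis.algebra
  show "(36::'k) \<noteq> 0" using two_three_smooth_nonzero[of 2 2] by simp
qed (simp_all add: poly_f1728)

subsection \<open>Rational roots of the level 5 modular polynomial\<close>

lemma card_modular5_roots: "finite {n. modular5 j n = 0}" "card {n::'k. modular5 j n = 0} \<le> 6"
proof -
  let ?p = "[:5, -10, 1:]^3 + [:0, j:] :: 'k poly"
  have poly: "poly ?p n = modular5 j n" for n
    by (simp add: modular5_def algebra_simps power2_eq_square)
  have deg: "degree ?p = 6"
    by (subst degree_add_eq_left) (simp_all add: degree_power_eq)
  then have "?p \<noteq> 0" by (metis degree_0 zero_neq_numeral)
  then show "finite {n. modular5 j n = 0}" "card {n::'k. modular5 j n = 0} \<le> 6"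
    using poly_roots_finite[of ?p] card_poly_roots_bound[of ?p] deg unfolding poly by simp_all
qed

lemma modular5_roots:
  assumes j: "j \<noteq> 0" "j \<noteq> 1728" and "r \<noteq> 0"
    and root: "n * hauptmodul5 (r^5) = 125" "modular5 j n = 0"
  shows "{k. modular5 j k = 0} = insert n (conjugate_root ` {s::'k. s^5 = r^5})"
proof -
  let ?S = "{s::'k. s^5 = r^5}"
  have "of_nat 5 \<noteq> (0::'k)" using five_neq_0 by simp
  then have card_S: "finite ?S" "card ?S = 5" using card_nth_roots[of 5 "r^5"] \<open>r \<noteq> 0\<close> by simp_all
  have nonzero: "s \<noteq> 0" if "s \<in> ?S" for s using that \<open>r \<noteq> 0\<close> by auto
  have root_S: "n * hauptmodul5 (s^5) = 125" if "s \<in> ?S" for s using that root(1) by simp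
  have "inj_on conjugate_root ?S"
    using conjugate_root_inj[OF five_neq_0 root_S root(2) nonzero two_neq_0 three_neq_0 j]
    by (auto intro: inj_onI)
  moreover have "n \<notin> conjugate_root ` ?S"
    using conjugate_root_neq[OF five_neq_0 root_S root(2) nonzero j] by auto
  ultimately have "card (insert n (conjugate_root ` ?S)) = 6"
    using card_S by (simp add: card_image)
  moreover have "insert n (conjugate_root ` ?S) \<subseteq> {k. modular5 j k = 0}"
    using modular5_conjugate_root[OF five_neq_0 root_S root(2) nonzero] root(2) by auto
  ultimately show ?thesis
    using card_modular5_roots[of j] card_seteq by metis
qed

lemma frob_conjugate_root: "frob m (conjugate_root r) = conjugate_root (frob m r)"
  by (simp add: conjugate_root_def hauptmodul5_def hauptmodul25_def hom_distribs)

text \<open>Frobenius permutes the conjugate roots as it permutes the fifth roots \<open>s\<close> of \<open>r\<^sup>5\<close>, and \<open>r\<close> is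
  the only rational one.\<close>

lemma conjugate_root_Fq_iff:
  assumes j: "j \<noteq> 0" "j \<noteq> 1728" and r_Fq: "r \<in> Fq 1" "r \<noteq> 0"
    and root: "n * hauptmodul5 (r^5) = 125" "modular5 j n = 0" and same_power: "s^5 = r^5"
  shows "conjugate_root s \<in> Fq 1 \<longleftrightarrow> s = r"
proof
  assume "conjugate_root s \<in> Fq 1"
  then have "conjugate_root (frob 1 s) = conjugate_root s"
    by (simp add: Fq_def flip: frob_conjugate_root)
  moreover have "frob 1 s ^ 5 = s^5"
    using r_Fq(1) unfolding frob.hom_power[symmetric] same_power by (simp add: Fq_def hom_distribs)
  moreover have "n * hauptmodul5 (s^5) = 125" "s \<noteq> 0" using root(1) same_power r_Fq(2) by auto
  ultimately have "frob 1 s = s"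
    using conjugate_root_inj[OF five_neq_0 _ root(2) _ two_neq_0 three_neq_0] j by blast
  then show "s = r"
    using bij_betw_fifth_power r_Fq(1) same_power
    by (auto simp: Fq_def dest!: bij_betw_imp_inj_on inj_onD)
next
  assume "s = r"
  then show "conjugate_root s \<in> Fq 1"
    using r_Fq(1) by (simp add: Fq_def frob_conjugate_root)
qed

lemma split5_conjugate_root:
  assumes "j \<noteq> 1728" and r_Fq: "r \<in> Fq 1" "r \<noteq> 0"
    and root: "n * hauptmodul5 (r^5) = 125" "modular5 j n = 0"
  shows "split5 (conjugate_root r)"
proof -
  define p w where "p = hauptmodul25 r" and
    "w = p * (r + 1/r) * (p^4 - 10*p^3 + 45*p^2 - 100*p + 125) / hauptmodul5 (r^5)"
  have w_sq: "w^2 = (conjugate_root r - 11)^2 + 4"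
    using conjugate_root_discriminant[OF r_Fq(2) factor_of_125_nonzero[OF five_neq_0 root(1)]]
    by (simp add: w_def p_def)
  have "(conjugate_root r - 11)^2 + 4 \<noteq> 0"
    using modular5_j_1728[OF five_neq_0 modular5_conjugate_root[OF five_neq_0 root r_Fq(2)]]
      assms(1) by blast
  then have "w \<noteq> 0" using w_sq by auto
  moreover have "conjugate_root r \<in> Fq 1" using r_Fq(1) by (simp add: Fq_def frob_conjugate_root)
  moreover have "w \<in> Fq 1"
    unfolding w_def p_def using r_Fq(1) by (auto intro!: Fq_closed hauptmodul5_Fq hauptmodul25_Fq)
  ultimately show ?thesis using w_sq unfolding split5_def by blast
qed

lemma split5_fricke:
  assumes "split5 n" "n \<noteq> 0" shows "split5 (125 / n)"
proof -
  obtain w where sqrt_disc: "w \<in> Fq 1" "w \<noteq> 0" "w^2 = (n - 11)^2 + 4" and n_Fq: "n \<in> Fq 1"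
    using assms(1) by (auto simp: split5_def)
  obtain s where sqrt5: "s \<in> Fq 1" "s \<noteq> 0" "s^2 = 5" by (rule sqrt5_exists)
  have "(5 * s * w / n)^2 = 25 * s^2 * w^2 / n^2" by (simp add: power_mult_distrib power_divide)
  also have "\<dots> = (125 / n - 11)^2 + 4"
    unfolding sqrt5 sqrt_disc using assms(2) by (simp add: field_simps power2_eq_square)
  finally have "(5 * s * w / n)^2 = (125 / n - 11)^2 + 4" .
  moreover have "5 * s * w / n \<in> Fq 1" "5 * s * w / n \<noteq> 0" "125 / n \<in> Fq 1"
    using sqrt5 sqrt_disc n_Fq assms(2) five_neq_0 by (auto intro!: Fq_closed)
  ultimately show ?thesis unfolding split5_def by blast
qed

lemma split5_fricke_param:
  assumes "split5 n" "n \<noteq> 0"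
  obtains r where "r \<in> Fq 1" "r \<noteq> 0" "n * hauptmodul5 (r^5) = 125"
proof -
  have "fibre5 (125 / n) \<noteq> {}" using card_fibre5[OF split5_fricke[OF assms]] by auto
  then obtain x where fibre_point: "x \<in> Fq 1" "x \<noteq> 0" "hauptmodul5 x = 125 / n"
    by (auto simp: fibre5_def)
  moreover have "x \<in> (\<lambda>r. r^5) ` Fq 1"
    using fibre_point(1) bij_betw_imp_surj_on[OF bij_betw_fifth_power] by simp
  ultimately obtain r where "r \<in> Fq 1" "r^5 = x" by blast
  then show thesis using that[of r] fibre_point assms(2) by auto
qed

lemma modular5_rational_roots:
  assumes j: "j \<noteq> 0" "j \<noteq> 1728" and root: "split5 n" "modular5 j n = 0"
  obtains n' where "n' \<noteq> n" "split5 n'" "\<And>k. k \<in> Fq 1 \<Longrightarrow> modular5 j k = 0 \<longleftrightarrow> k = n \<or> k = n'"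
proof -
  have "n \<noteq> 0" using modular5_nonzero_root[OF five_neq_0 root(2)] .
  then obtain r where param: "r \<in> Fq 1" "r \<noteq> 0" "n * hauptmodul5 (r^5) = 125"
    using split5_fricke_param root(1) by blast
  show thesis
  proof (rule that)
    show "conjugate_root r \<noteq> n"
      using conjugate_root_neq[OF five_neq_0 param(3) root(2) param(2) j] .
    show "split5 (conjugate_root r)" using split5_conjugate_root[OF j(2) param root(2)] .
    fix k assume "k \<in> Fq 1"
    then show "modular5 j k = 0 \<longleftrightarrow> k = n \<or> k = conjugate_root r"
      using modular5_roots[OF j param(2,3) root(2)] conjugate_root_Fq_iff[OF j param root(2)]
      by blast
  qed
qed

lemma card_roots_fj:
  assumes j: "j \<noteq> 0" "j \<noteq> 1728" and root: "x \<in> Fq 1" "poly (fj j) x = 0"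
  shows "card {x \<in> Fq 1. poly (fj j) x = 0} = 4"
proof -
  have root_iff: "poly (fj j) x = 0 \<longleftrightarrow> x \<noteq> 0 \<and> modular5 j (hauptmodul5 x) = 0" for x :: 'k
    using poly_fj_hauptmodul5[of x j] by (cases "x = 0") (simp_all add: poly_fj poly_f0)
  define n where "n = hauptmodul5 x"
  have n_root: "x \<noteq> 0" "modular5 j n = 0" using root(2) root_iff by (simp_all add: n_def)
  then have "(n - 11)^2 + 4 \<noteq> 0" using modular5_j_1728[OF five_neq_0 n_root(2)] j(2) by blast
  then have "split5 n" using split5_hauptmodul5 root(1) n_root(1) by (simp add: n_def)
  then obtain n' where other_root: "n' \<noteq> n" "split5 n'"
    and rational: "\<And>k. k \<in> Fq 1 \<Longrightarrow> modular5 j k = 0 \<longleftrightarrow> k = n \<or> k = n'"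
    using modular5_rational_roots[OF j _ n_root(2)] by metis
  have "{x \<in> Fq 1. poly (fj j) x = 0} = fibre5 n \<union> fibre5 n'"
    using rational hauptmodul5_Fq by (auto simp: root_iff fibre5_def)
  then show ?thesis using card_two_fibres5 \<open>split5 n\<close> other_root by simp
qed

end

section \<open>Rational models of supersingular curves\<close>

fun ec_scale :: "'k::field \<Rightarrow> 'k ec_point \<Rightarrow> 'k ec_point" where
  "ec_scale u Inf = Inf"
| "ec_scale u (Pt x y) = Pt (u^2 * x) (u^3 * y)"

lemma ec_scale_eq_Inf_iff [simp]: "ec_scale u P = Inf \<longleftrightarrow> P = Inf"
  by (cases P) auto

lemma discriminant_scale:
  fixes u a b :: "'k::field"
  shows "4 * (u^4 * a)^3 + 27 * (u^6 * b)^2 = u^12 * (4 * a^3 + 27 * b^2)"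
  by Groebner_Basis.algebra

context
  fixes u a b :: "'k::field"
  assumes u_nonzero: "u \<noteq> 0"
begin

lemma on_curve_scale: "on_curve (u^4 * a) (u^6 * b) (ec_scale u P) \<longleftrightarrow> on_curve a b P"
proof (cases P)
  case (Pt x y)
  have "(u^3 * y)^2 = u^6 * y^2"
    "(u^2 * x)^3 + u^4 * a * (u^2 * x) + u^6 * b = u^6 * (x^3 + a*x + b)"
    by Groebner_Basis.algebra+
  then show ?thesis using Pt u_nonzero by (auto simp del: power_mult_distrib)
qed simp

lemma ec_slope_scale:
  "ec_slope (u^4 * a) (u^2 * x1) (u^3 * y1) (u^2 * x2) (u^3 * y2) = u * ec_slope a x1 y1 x2 y2"
proof (cases "x1 = x2")
  case True
  have "3 * (u^2 * x1)^2 + u^4 * a = u^3 * (u * (3 * x1^2 + a))" by Groebner_Basis.algebra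
  moreover have "2 * (u^3 * y1) = u^3 * (2 * y1)" by simp
  ultimately have "(3 * (u^2 * x1)^2 + u^4 * a) / (2 * (u^3 * y1)) = u * (3 * x1^2 + a) / (2 * y1)"
    using u_nonzero by (metis mult_divide_mult_cancel_left power_not_zero)
  then show ?thesis using True by (simp add: ec_slope_def)
next
  case False
  have "u^3 * y2 - u^3 * y1 = u^2 * (u * (y2 - y1))" "u^2 * x2 - u^2 * x1 = u^2 * (x2 - x1)"
    by Groebner_Basis.algebra+
  then have "(u^3 * y2 - u^3 * y1) / (u^2 * x2 - u^2 * x1) = u * (y2 - y1) / (x2 - x1)"
    using u_nonzero by (metis mult_divide_mult_cancel_left power_not_zero)
  then show ?thesis using False u_nonzero by (simp add: ec_slope_def)
qed

lemma ec_add_scale: "ec_add (u^4 * a) (ec_scale u P) (ec_scale u Q) = ec_scale u (ec_add a P Q)"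
proof (cases P; cases Q)
  fix x1 y1 x2 y2 assume points: "P = Pt x1 y1" "Q = Pt x2 y2"
  have "u^3 * y1 = - (u^3 * y2) \<longleftrightarrow> y1 = - y2"
    using u_nonzero by (metis mult_left_cancel mult_minus_right power_not_zero)
  moreover have
    "chord_sum (u * m) (u^2 * x1) (u^3 * y1) (u^2 * x2) = ec_scale u (chord_sum m x1 y1 x2)"
    for m
    by (simp add: chord_sum_def algebra_simps power2_eq_square power3_eq_cube)
  ultimately show ?thesis using u_nonzero by (simp add: points ec_add_Pt ec_slope_scale)
qed auto

lemma ec_mult_scale: "ec_mult (u^4 * a) n (ec_scale u P) = ec_scale u (ec_mult a n P)"
  by (induction n) (simp_all add: ec_add_scale)

lemma supersingular_curve_scale:
  assumes "supersingular_curve l a b" shows "supersingular_curve l (u^4 * a) (u^6 * b)"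
  unfolding supersingular_curve_def
proof (intro allI impI)
  fix P assume torsion: "on_curve (u^4 * a) (u^6 * b) P \<and> ec_mult (u^4 * a) l P = Inf"
  have "P = ec_scale u (case P of Inf \<Rightarrow> Inf | Pt x y \<Rightarrow> Pt (x/u^2) (y/u^3))"
    using u_nonzero by (cases P) simp_all
  then obtain Q where P_eq: "P = ec_scale u Q" by blast
  then have "on_curve a b Q" "ec_mult a l Q = Inf"
    using torsion by (simp_all add: on_curve_scale ec_mult_scale)
  then show "P = Inf" using assms P_eq by (auto simp: supersingular_curve_def)
qed

lemma elliptic_scale: "elliptic (u^4 * a) (u^6 * b) \<longleftrightarrow> elliptic a b"
  using u_nonzero unfolding elliptic_def discriminant_scale by simp

lemma j_invariant_scale: "j_invariant (u^4 * a) (u^6 * b) = j_invariant a b"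
proof -
  have numerator: "1728 * (4 * (u^4 * a)^3) = u^12 * (1728 * (4 * a^3))"
    by Groebner_Basis.algebra
  show ?thesis unfolding j_invariant_def discriminant_scale numerator using u_nonzero by simp
qed

end

context alg_closed_field_char_4_mod_5
begin

lemma coefficient_Fq_if_j_invariant_Fq:
  fixes c :: 'k
  assumes "elliptic c c" "j_invariant c c = j" "j \<in> Fq m" shows "c \<in> Fq m"
proof -
  have discriminant: "4 * c^3 + 27 * c^2 = c^2 * (4 * c + 27)" by Groebner_Basis.algebra
  then have nonzero: "c \<noteq> 0" "4 * c + 27 \<noteq> 0" using assms(1) by (auto simp: elliptic_def)
  have "c^2 * (1728 * (4 * c)) = 1728 * (4 * c^3)" by Groebner_Basis.algebra
  also have "\<dots> = j * (4 * c^3 + 27 * c^2)"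
    using assms(1,2) by (simp add: j_invariant_def elliptic_def nonzero_divide_eq_eq)
  also have "\<dots> = c^2 * (j * (4 * c + 27))" unfolding discriminant by (simp add: mult_ac)
  finally have j_eq: "1728 * (4 * c) = j * (4 * c + 27)"
    using nonzero(1) by (metis mult_left_cancel power_not_zero)
  have "4 * (1728 - j) * c = 1728 * (4 * c) - j * (4 * c)" by Groebner_Basis.algebra
  also have "\<dots> = 27 * j" unfolding j_eq by Groebner_Basis.algebra
  finally have c_eq: "4 * (1728 - j) * c = 27 * j" .
  moreover have "j \<noteq> 0"
    using j_eq nonzero two_three_smooth_nonzero[of 8 3] by auto
  then have "27 * j \<noteq> 0" using two_three_smooth_nonzero[of 0 3] by simp
  ultimately have "4 * (1728 - j) \<noteq> 0" by auto
  then have "c = 27 * j / (4 * (1728 - j))"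
    using c_eq by (simp add: nonzero_eq_divide_eq mult.commute)
  then show ?thesis using assms(3) by (auto intro!: Fq_closed)
qed

text \<open>Scaling leads to \<open>y\<^sup>2 = x\<^sup>3 + 1\<close>, \<open>y\<^sup>2 = x\<^sup>3 + x\<close> or \<open>y\<^sup>2 = x\<^sup>3 + c x + c\<close>; in the last case
  \<open>c\<close> is a rational function of \<open>j\<close>.\<close>

lemma rational_scaling_exists:
  fixes a b :: 'k
  assumes "elliptic a b" "j_invariant a b \<in> Fq m"
  shows "\<exists>u. u \<noteq> 0 \<and> u^4 * a \<in> Fq m \<and> u^6 * b \<in> Fq m"
proof -
  consider (a_0) "a = 0" "b \<noteq> 0" | (b_0) "a \<noteq> 0" "b = 0" | (generic) "a \<noteq> 0" "b \<noteq> 0"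
    using assms(1) by (cases "a = 0"; cases "b = 0") (auto simp: elliptic_def)
  then show ?thesis
  proof cases
    case a_0
    obtain u where "u^6 = 1/b" using nth_root_exists[of 6] by auto
    with a_0 show ?thesis by (intro exI[of _ u]) auto
  next
    case b_0
    obtain u where "u^4 = 1/a" using nth_root_exists[of 4] by auto
    with b_0 show ?thesis by (intro exI[of _ u]) auto
  next
    case generic
    obtain u where "u^2 = a/b" using nth_root_exists[of 2] by auto
    then have "u \<noteq> 0" "u^2 * b = a" using generic by auto
    moreover have "u^6 * b = u^4 * (u^2 * b)" by Groebner_Basis.algebra
    ultimately have "u^6 * b = u^4 * a" by simp
    moreover from this have "u^4 * a \<in> Fq m"
      using coefficient_Fq_if_j_invariant_Fq[of "u^4 * a"] elliptic_scale[OF \<open>u \<noteq> 0\<close>, of a b]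
        j_invariant_scale[OF \<open>u \<noteq> 0\<close>, of a b] assms by simp
    ultimately show ?thesis using \<open>u \<noteq> 0\<close> by auto
  qed
qed

lemma supersingular_rational_model:
  assumes "supersingular_j l j" "j \<in> Fq m"
  obtains a b where "a \<in> Fq m" "b \<in> Fq m" "elliptic a b" "j_invariant a b = j"
    "supersingular_curve l a b"
proof -
  obtain a b where curve: "elliptic a b" "j_invariant a b = j" "supersingular_curve l a b"
    using assms(1) by (auto simp: supersingular_j_def)
  then obtain u where u: "u \<noteq> 0" "u^4 * a \<in> Fq m" "u^6 * b \<in> Fq m"
    using rational_scaling_exists assms(2) by metis
  show thesis
    by (rule that[OF u(2,3)])
      (simp_all add: curve u(1) supersingular_curve_scale elliptic_scale j_invariant_scale)
qed

end

section \<open>Supersingular invariants as roots\<close>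

context alg_closed_field_char_4_mod_5
begin

lemma supersingular_tate_form:
  assumes "elliptic a b" "a \<in> Fq 1" "b \<in> Fq 1" "supersingular_curve l a b"
  obtains M x where "x \<in> Fq 1" "M \<noteq> 0" "tate_form M x a b" "b = 0 \<Longrightarrow> x^2 + 1 \<noteq> 0"
proof -
  interpret elliptic_curve_over_prime_field K l a b
    using two_neq_0 assms l_gt_3 by unfold_locales auto
  have hasse: "hasse 1 = 0" using supersingular_imp_hasse_0 assms(4) by blast
  have "5 dvd l + 1" using l_mod_5 by presburger
  then obtain P where order_five: "P \<in> carrier (point_group 1)" "P \<noteq> Inf" "ec_mult a 5 P = Inf"
    using torsion_point_exists[of 1 5] card_point_group_if_hasse_0[OF hasse] by auto
  then have "on P" "rational 1 P" by (simp_all add: carrier_point_group)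
  then obtain M x where "x \<in> Fq 1" "M \<noteq> 0" "tate_form M x a b"
    using five_torsion_tate_form order_five by blast
  moreover have "x^2 + 1 \<noteq> 0" if "b = 0"
    using four_dvd_if_minus_1_square[OF l_ne_2 \<open>x \<in> Fq 1\<close>] hasse_1_nonzero_if_b_0[OF that] hasse
    by auto
  ultimately show thesis using that by blast
qed

lemma supersingular_j_tate_form:
  assumes "supersingular_j l j" "j \<in> Fq 1"
  obtains a b M x where "elliptic a b" "j_invariant a b = j" "x \<in> Fq 1" "M \<noteq> 0"
    "tate_form M x a b" "b = 0 \<Longrightarrow> x^2 + 1 \<noteq> 0"
  using supersingular_rational_model[OF assms] supersingular_tate_form by metis

lemma supersingular_j_0_root:
  assumes "supersingular_j l (0::'k)" shows "\<exists>x\<in>Fq 1. poly f0 x = (0::'k)"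
proof -
  obtain a b M x :: 'k where curve: "elliptic a b" "j_invariant a b = 0"
    and tate: "x \<in> Fq 1" "M \<noteq> 0" "tate_form M x a b"
    using supersingular_j_tate_form[OF assms Fq_0] by metis
  have "a = 0"
    using curve two_three_smooth_nonzero[of 8 3] by (auto simp: j_invariant_def elliptic_def)
  then show ?thesis using tate by (auto simp: tate_form_def)
qed

lemma supersingular_j_1728_root:
  assumes "supersingular_j l (1728::'k)" shows "\<exists>x\<in>Fq 1. poly f1728 x = (0::'k)"
proof -
  obtain a b M x :: 'k where curve: "elliptic a b" "j_invariant a b = 1728"
    and tate: "x \<in> Fq 1" "M \<noteq> 0" "tate_form M x a b" "b = 0 \<Longrightarrow> x^2 + 1 \<noteq> 0"
    using supersingular_j_tate_form[OF assms Fq_numeral] by metis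
  have nonzero: "(1728::'k) \<noteq> 0" "(27::'k) \<noteq> 0"
    using two_three_smooth_nonzero[of 6 3] two_three_smooth_nonzero[of 0 3] by simp_all
  have "1728 * (4 * a^3) = 1728 * (4 * a^3 + 27 * b^2)"
    using curve by (simp add: j_invariant_def elliptic_def nonzero_divide_eq_eq)
  then have "4 * a^3 = 4 * a^3 + 27 * b^2" unfolding mult_left_cancel[OF nonzero(1)] .
  then have "b = 0" using nonzero(2) by simp
  then show ?thesis using tate by (auto simp: tate_form_def)
qed

lemma supersingular_j_root:
  assumes "supersingular_j l j" "j \<in> Fq 1" shows "\<exists>x\<in>Fq 1. poly (fj j) x = 0"
  using supersingular_j_tate_form[OF assms] fj_root_if_tate_form[OF two_neq_0 three_neq_0] by metis

end

section \<open>Passage to the prime field\<close>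

lemma num_distinct_linear_factors_eq:
  "num_distinct_linear_factors (f :: 'a::field poly) = card {x. poly f x = 0}"
proof -
  have "{g. monic g \<and> degree g = 1 \<and> g dvd f} = (\<lambda>x. [:- x, 1:]) ` {x. poly f x = 0}"
  proof (intro equalityI subsetI)
    fix g assume "g \<in> {g. monic g \<and> degree g = 1 \<and> g dvd f}"
    then have g_factor: "monic g" "degree g = 1" "g dvd f" by auto
    then obtain c d where g_eq: "g = [:c, d:]" by (metis degree1_coeffs)
    then have "d = 1" using g_factor by (auto split: if_splits)
    then have "g = [:- (- c), 1:]" using g_eq by simp
    then show "g \<in> (\<lambda>x. [:- x, 1:]) ` {x. poly f x = 0}"
      using g_factor(3) poly_eq_0_iff_dvd[of f "- c"] by blast
  qed (auto simp: poly_eq_0_iff_dvd)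
  moreover have "inj_on (\<lambda>x. [:- x, 1:]) {x. poly f x = 0}" by (auto simp: inj_on_def)
  ultimately show ?thesis by (simp add: num_distinct_linear_factors_def card_image)
qed

lemma alg_closed_prime_char_field_if_alg_closure:
  assumes "is_alg_closure_of_Fp l TYPE('k::field)"
  shows "alg_closed_prime_char_field TYPE('k) l"
proof
  show "prime l" using assms by (simp add: is_alg_closure_of_Fp_def)
  then show "CHAR('k) = l"
    using assms unfolding is_alg_closure_of_Fp_def
    by (metis CHAR_not_1' One_nat_def of_nat_eq_0_iff_char_dvd prime_nat_iff)
qed (use assms in \<open>auto simp: is_alg_closure_of_Fp_def\<close>)

locale mod_ring_closure = alg_closed_prime_char_field K "CARD('p)"
  for K :: "'k::field itself" and P :: "'p::prime_card itself"
begin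

lemma of_int_mod_CARD: "of_int (i mod int CARD('p)) = (of_int i :: 'k)"
  by (simp add: of_int_eq_iff_cong_CHAR CHAR_eq cong_def)

sublocale emb: field_hom "emb :: 'p mod_ring \<Rightarrow> 'k"
  by unfold_locales
    (simp_all add: emb_def to_int_mod_ring_add to_int_mod_ring_mult of_int_mod_CARD)

lemma range_emb: "range (emb :: 'p mod_ring \<Rightarrow> 'k) = Fq 1"
proof (rule card_subset_eq)
  show "range (emb :: 'p mod_ring \<Rightarrow> 'k) \<subseteq> Fq 1"
    by (auto simp: Fq_def emb_def frob.hom_of_int)
  show "card (range (emb :: 'p mod_ring \<Rightarrow> 'k)) = card (Fq 1)"
    using card_image[OF emb.inj_f] by (simp add: card_Fq)
qed (simp add: finite_Fq)

lemma num_distinct_linear_factors_emb: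
  fixes f :: "'p mod_ring poly"
  assumes "\<And>x. poly g (emb x :: 'k) = emb (poly f x)"
  shows "num_distinct_linear_factors f = card {x \<in> Fq 1. poly g x = 0}"
proof -
  have "{x \<in> range (emb :: 'p mod_ring \<Rightarrow> 'k). poly g x = 0} =
      emb ` {x :: 'p mod_ring. poly g (emb x) = 0}"
    by auto
  then have "{x \<in> Fq 1. poly g x = 0} = emb ` {x. poly f x = 0}"
    unfolding range_emb assms by simp
  moreover have "inj_on (emb :: 'p mod_ring \<Rightarrow> 'k) {x. poly f x = 0}" by (simp add: inj_on_def)
  ultimately show ?thesis by (simp add: num_distinct_linear_factors_eq card_image)
qed

lemma num_distinct_linear_factors_f0:
  "num_distinct_linear_factors (f0 :: 'p mod_ring poly) = card {x \<in> Fq 1. poly f0 x = (0::'k)}"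
  by (intro num_distinct_linear_factors_emb) (simp add: poly_f0 hom_distribs)

lemma num_distinct_linear_factors_f1728:
  "num_distinct_linear_factors (f1728 :: 'p mod_ring poly) =
    card {x \<in> Fq 1. poly f1728 x = (0::'k)}"
  by (intro num_distinct_linear_factors_emb) (simp add: poly_f1728 hom_distribs)

lemma num_distinct_linear_factors_fj:
  "num_distinct_linear_factors (fj (j :: 'p mod_ring)) =
    card {x \<in> Fq 1. poly (fj (emb j)) x = (0::'k)}"
  by (intro num_distinct_linear_factors_emb) (simp add: poly_fj poly_f0 hom_distribs)

end

theorem theorem1p2:
  fixes TYPE_K :: "'k::field itself"
  assumes "[CARD('p::prime_card) = 4] (mod 5)"
    and "is_alg_closure_of_Fp CARD('p) TYPE('k)"
  shows "(supersingular_j CARD('p) (0::'k)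
            \<longrightarrow> num_distinct_linear_factors (f0 :: 'p mod_ring poly) = 4)
       \<and> (supersingular_j CARD('p) (1728::'k)
            \<longrightarrow> num_distinct_linear_factors (f1728 :: 'p mod_ring poly) = 4)
       \<and> (\<forall>j::'p mod_ring. j \<noteq> 0 \<and> j \<noteq> 1728 \<and> supersingular_j CARD('p) (emb j :: 'k)
            \<longrightarrow> num_distinct_linear_factors (fj j) = 4)"
proof -
  interpret alg_closed_prime_char_field "TYPE('k)" "CARD('p)"
    using alg_closed_prime_char_field_if_alg_closure[OF assms(2)] .
  interpret alg_closed_field_char_4_mod_5 "TYPE('k)" "CARD('p)"
    using assms(1) by unfold_locales (simp add: cong_def)
  interpret mod_ring_closure "TYPE('k)" "TYPE('p)" ..
  have "num_distinct_linear_factors (fj j) = 4"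
    if "j \<noteq> 0" "j \<noteq> 1728" "supersingular_j CARD('p) (emb j :: 'k)" for j :: "'p mod_ring"
  proof -
    have "(emb j :: 'k) \<in> Fq 1" "(emb j :: 'k) \<noteq> 0" "(emb j :: 'k) \<noteq> 1728"
      using range_emb that(1,2) emb.eq_iff[of j 1728] by (auto simp: emb.hom_numeral)
    then show ?thesis
      using supersingular_j_root[OF that(3)] card_roots_fj
      unfolding num_distinct_linear_factors_fj by blast
  qed
  then show ?thesis
    using supersingular_j_0_root card_roots_f0 supersingular_j_1728_root card_roots_f1728
    unfolding num_distinct_linear_factors_f0 num_distinct_linear_factors_f1728 by blast
qed

end
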